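(* Let $d\geq 2$ and $\delta>0$. (i) Let $(a_n)_{n\ge1}$ be a sequence of distinct integers. Then for almost all $\boldsymbol{\alpha}\in[0,1]^d$ the minimal gap of $(\{a_n\boldsymbol{\alpha}\})_n$ satisfies $$\delta_{\min}^{\infty}(\boldsymbol{\alpha},N)\leq \frac{(\log N)^{1+1/d+\delta}}{C_N^{1/d}}\quad\text{for all sufficiently large } N.$$ (ii) Let $(a_n^{(1)})_{n\ge1},\ldots,(a_n^{(d)})_{n\ge1}$ be strictly increasing sequences of natural numbers, and $\boldsymbol{a}_n=(a_n^{(1)},\ldots,a_n^{(d)})$. If for all $D'\subset D=\{1,\dots,d\}$ with $|D'|>d/2$ the joint additive energy satisfies $E(\boldsymbol{A}_N^{D'})\ll N^{2+o(1)}$, then for almost all $\boldsymbol{\alpha}\in[0,1]^d$ the minimal gap of $(\{\boldsymbol{a}_n\boldsymbol{\alpha}\})_n$ satisfies $$\delta_{\min}^{\infty}(\boldsymbol{\alpha},N)\leq \frac{N^{\delta}}{N^{2/d}}\quad\text{for all sufficiently large } N.$$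
   Context: Notation. $\{\cdot\}$ is the fractional part and "almost all" refers to Lebesgue measure on $[0,1]^d$; "sufficiently large" may depend on $\boldsymbol{\alpha}$. The inclusion $D'\subset D$ is not assumed proper ($D'=D$ is allowed). The condition $E\ll N^{2+o(1)}$ means that for every $\eta>0$ one has $E\ll_\eta N^{2+\eta}$ as $N\to\infty$. For $\boldsymbol{\alpha}=(\alpha_1,\dots,\alpha_d)$ put $\{\boldsymbol{a}_n\boldsymbol{\alpha}\}=(\{a_n^{(1)}\alpha_1\},\dots,\{a_n^{(d)}\alpha_d\})$ and $\{a_n\boldsymbol{\alpha}\}=(\{a_n\alpha_1\},\dots,\{a_n\alpha_d\})$. Minimal gap: for $\boldsymbol{x}\in\mathbb{R}^d$ let $\|\boldsymbol{x}\|_\infty^{(\mathrm{nid})}=\min_{\boldsymbol{k}\in\mathbb{Z}^d}|\boldsymbol{x}+\boldsymbol{k}|_\infty$, where $|\cdot|_\infty$ is the sup norm. For a sequence $(\boldsymbol{x}_n)$ in $[0,1)^d$ the minimal gap is $\min\{\|\boldsymbol{x}_n-\boldsymbol{x}_m\|_\infty^{(\mathrm{nid})}:1\le m\ne n\le N\}$. It is denoted $\delta_{\min}^{\infty}(\boldsymbol{\alpha},N)$ when the sequence is $(\{\boldsymbol{a}_n\boldsymbol{\alpha}\})$ or $(\{a_n\boldsymbol{\alpha}\})$. Difference set: $A_N=\{a_1,\dots,a_N\}$, $(A_N-A_N)^+=\{c>0:c=a_n-a_m\text{ for some }a_n,a_m\in A_N\}$ and $C_N=\#(A_N-A_N)^+$.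 Joint additive energy: for $D'\subset D$ let $\boldsymbol{a}_n^{D'}=(a_n^{(i)})_{i\in D'}$ and $\boldsymbol{A}_N^{D'}=\{\boldsymbol{a}_n^{D'}:n\le N\}$. Then $$E(\boldsymbol{A}_N^{D'})=\#\{(n_1,n_2,n_3,n_4)\in[1,N]^4\cap\mathbb{N}^4:\boldsymbol{a}_{n_1}^{D'}+\boldsymbol{a}_{n_2}^{D'}=\boldsymbol{a}_{n_3}^{D'}+\boldsymbol{a}_{n_4}^{D'}\}.$$ *)

theory Defs
  imports "HOL-Analysis.Analysis" "HOL-Library.Landau_Symbols"
begin

text \<open>
  Points of \<open>\<real>\<^sup>d\<close> have type \<open>real ^ 'd\<close> with \<open>d = CARD('d)\<close>, and the index set
  \<open>D = {1,\<dots>,d}\<close> is the type \<open>'d\<close>.  Sequences start at index \<open>1\<close>; their value at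
  \<open>0\<close> is never used.
\<close>

definition frac_vec :: "real ^ 'd \<Rightarrow> real ^ 'd" where
  "frac_vec x = (\<chi> i. frac (x $ i))"

definition int_vec :: "int ^ 'd \<Rightarrow> real ^ 'd" where
  "int_vec k = (\<chi> i. real_of_int (k $ i))"

text \<open>The infimum below is a minimum, see \<open>nid_infnorm_attained\<close>.\<close>

definition nid_infnorm :: "real ^ 'd \<Rightarrow> real" where
  "nid_infnorm x = (INF k. infnorm (x + int_vec k))"

lemma nid_infnorm_attained: "\<exists>k. nid_infnorm x = infnorm (x + int_vec k)"
proof -
  define k where "k = (\<chi> i. - round (x $ i))"
  have "infnorm (x + int_vec k) \<le> infnorm (x + int_vec l)" for l
  proof -
    have bound: "\<bar>(x + int_vec k) $ i\<bar> \<le> infnorm (x + int_vec l)" for i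
    proof -
      have "\<bar>(x + int_vec k) $ i\<bar> = \<bar>x $ i - of_int (round (x $ i))\<bar>"
        by (simp add: k_def int_vec_def)
      also have "\<dots> \<le> \<bar>x $ i - of_int (- l $ i)\<bar>"
        by (rule round_diff_minimal)
      also have "\<dots> = \<bar>(x + int_vec l) $ i\<bar>"
        by (simp add: int_vec_def)
      also have "\<dots> \<le> infnorm (x + int_vec l)"
        by (rule component_le_infnorm_cart)
      finally show ?thesis .
    qed
    have "{\<bar>(x + int_vec k) $ i\<bar> |i. i \<in> UNIV} \<noteq> {}"
      by blast
    then show ?thesis
      unfolding infnorm_cart[of "x + int_vec k"] using bound by (intro cSup_least) auto
  qed
  then have "nid_infnorm x = infnorm (x + int_vec k)"
    unfolding nid_infnorm_def by (intro cInf_eq_minimum) auto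
  then show ?thesis ..
qed

text \<open>Only meaningful for \<open>N \<ge> 2\<close>; otherwise the set of gaps is empty.\<close>

definition min_gap :: "(nat \<Rightarrow> real ^ 'd) \<Rightarrow> nat \<Rightarrow> real" where
  "min_gap x N = Min {nid_infnorm (x n - x m) | n m. n \<in> {1..N} \<and> m \<in> {1..N} \<and> n \<noteq> m}"

definition pos_diffs :: "int set \<Rightarrow> int set" where
  "pos_diffs A = {c. c > 0 \<and> (\<exists>x\<in>A. \<exists>y\<in>A. c = x - y)}"

definition num_pos_diffs :: "(nat \<Rightarrow> int) \<Rightarrow> nat \<Rightarrow> nat" where
  "num_pos_diffs a N = card (pos_diffs (a ` {1..N}))"

definition joint_energy :: "('d \<Rightarrow> nat \<Rightarrow> nat) \<Rightarrow> 'd set \<Rightarrow> nat \<Rightarrow> nat" where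
  "joint_energy a D' N =
     card {(n1, n2, n3, n4). n1 \<in> {1..N} \<and> n2 \<in> {1..N} \<and> n3 \<in> {1..N} \<and> n4 \<in> {1..N} \<and>
             (\<forall>i\<in>D'. a i n1 + a i n2 = a i n3 + a i n4)}"

end

theory Submission
  imports Defs "HOL-Computational_Algebra.Primes" "HOL-Real_Asymp.Real_Asymp"
begin

text \<open>
  Both parts rest on the second moment method. For positive integer vectors \<open>c_p\<close> let \<open>f \<alpha>\<close> count the
  \<open>p\<close> such that every coordinate of \<open>c_p \<alpha>\<close> is within \<open>s\<close> of an integer. The mean of \<open>f\<close> is exactly
  \<open>(2 s)^d\<close> times the number of vectors, and the events for \<open>c\<close> and \<open>c'\<close> have joint probability at
  most \<open>\<Prod>i (4 s^2 + 2 s / v_i)\<close>, where \<open>v_i\<close> is the larger of the numerator and denominator of the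
  reduced fraction \<open>c_i / c'_i\<close>. Chebyshev's inequality bounds the measure of \<open>{f = 0}\<close>, and
  Borel--Cantelli applies along a sparse sequence of scales, because the minimal gap decreases in \<open>N\<close>.

  In (i) the vectors are constant, one for each of \<open>4^k\<close> chosen differences. At most \<open>2 w\<close> differences
  \<open>c'\<close> give \<open>v = w\<close> for a fixed \<open>c\<close>, which bounds the sums of \<open>1 / v\<close> and \<open>1 / v^2\<close>.

  In (ii) the vectors are \<open>a_n - a_m\<close> with \<open>m < n \<le> 2^k\<close>. Expanding the product over the coordinates
  leaves, for every nonempty \<open>D'\<close>, a GCD sum that is at most \<open>N^\<epsilon> E(D')\<close>. Such sums are quadratic
  forms of a kernel on the multiplicative group of positive rational vectors, and the divisor bound controls the
  entries of its powers. For \<open>|D'| \<le> d / 2\<close> the trivial bound \<open>E(D') \<le> N^3\<close> suffices.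
\<close>

section \<open>Dilates of an interval modulo one\<close>

text \<open>The integers are not bounded in terms of \<open>N\<close>, so the divisor bound cannot
  be applied to the differences. It is applied to reduced numerators and denominators only. The
  cut-off \<open>X\<close> in \<open>gcd_kernel\<close> keeps these below a fixed power of
  \<open>N\<close>, and a pair beyond the cut-off has a product of ratios of at most
  \<open>1 / X\<close>. Passing from \<open>1 / max u v\<close> to the larger
  \<open>1 / sqrt (u * v)\<close> gives a kernel in which two successive entries combine well.

  The threshold \<open>d / 2\<close> in (ii) comes from comparing sizes. There are about
  \<open>N^2\<close> vectors, so the squared mean is about \<open>N^4 * s^(2*d)\<close>, while the
  term of \<open>D'\<close> in the variance is about \<open>s^(2*d - |D'|) * E(D')\<close>. With
  \<open>s\<close> about \<open>N^(-2/d)\<close> this asks for \<open>E(D')\<close> below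
  \<open>N^(4 - 2*|D'|/d)\<close>: the bound \<open>N^3\<close> does this for
  \<open>|D'| \<le> d / 2\<close>, and the bound \<open>N^2\<close> for every \<open>D'\<close>. The
  factor \<open>N^\<delta>\<close> pays for all small losses.

  In (i) the variance divided by the squared mean is at most a constant times
  \<open>1 / (s * 2^k) + k / (s^d * 4^k)\<close>. With \<open>s\<close> about
  \<open>k^e / 4^(k/d)\<close> this is summable once \<open>e > 1\<close> and
  \<open>e * d > 2\<close>, which the exponent \<open>e = 1 + 1/d + \<delta>\<close>
  satisfies.\<close>

definition near_int :: "real \<Rightarrow> real \<Rightarrow> bool" where
  "near_int s y \<longleftrightarrow> \<bar>y - of_int (round y)\<bar> \<le> s"

lemma near_int_iff: "near_int s y \<longleftrightarrow> (\<exists>k::int. \<bar>y - of_int k\<bar> \<le> s)"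
  unfolding near_int_def using round_diff_minimal[of y] order_trans by blast

lemma near_int_add_of_int [simp]: "near_int s (of_int k + y) \<longleftrightarrow> near_int s y"
proof
  assume "near_int s (of_int k + y)"
  then obtain j :: int where "\<bar>of_int k + y - of_int j\<bar> \<le> s" by (auto simp: near_int_iff)
  then have "\<bar>y - of_int (j - k)\<bar> \<le> s" by (simp add: algebra_simps)
  then show "near_int s y" unfolding near_int_iff ..
next
  assume "near_int s y"
  then obtain j :: int where "\<bar>y - of_int j\<bar> \<le> s" by (auto simp: near_int_iff)
  then have "\<bar>of_int k + y - of_int (j + k)\<bar> \<le> s" by (simp add: algebra_simps)
  then show "near_int s (of_int k + y)" unfolding near_int_iff ..
qed

lemma sets_near_int [measurable]: "{y. near_int s y} \<in> sets borel"
proof -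
  have "{y. near_int s y} = (\<Union>k. cball (real_of_int k) s)"
    by (auto simp: near_int_iff dist_real_def abs_minus_commute)
  then show ?thesis by simp
qed

lemma pred_near_int [measurable]: "Measurable.pred borel (near_int s)"
  using sets_near_int[of s] by (simp add: pred_def)

text \<open>On the \<open>j\<close>-th of \<open>n\<close> equal pieces the substitution
  \<open>x = (j + t) / n\<close> gives \<open>n * x = j + t\<close>, and \<open>near_int\<close>
  ignores the integer \<open>j\<close>.\<close>

lemma nn_integral_unit_interval_split:
  fixes F :: "real \<Rightarrow> ennreal"
  assumes [measurable]: "F \<in> borel_measurable borel" and "n > 0"
  shows "(\<integral>\<^sup>+x. F x * indicator {0..1} x \<partial>lborel) =
    ennreal (1 / real n) * (\<integral>\<^sup>+t. (\<Sum>j<n. F ((real j + t) / real n)) * indicator {0..1} t \<partial>lborel)"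
proof -
  \<comment> \<open>Half-open pieces tile \<open>{0..<1}\<close> without overlap, so the indicators
    add up pointwise; only the null set \<open>{1}\<close> is lost.\<close>
  have half_open: "(\<integral>\<^sup>+x. G x * indicator {0..1} x \<partial>lborel) = (\<integral>\<^sup>+x. G x * indicator {0..<1} x \<partial>lborel)"
    for G :: "real \<Rightarrow> ennreal"
    using AE_lborel_singleton[of 1]
    by (intro nn_integral_cong_AE) (auto elim!: eventually_mono simp: indicator_def)
  have ind: "indicator {0..<1} x = (\<Sum>j<n. indicator {real j / n..<(real j + 1) / n} x :: ennreal)" for x
  proof (cases "x \<in> {0..<1}")
    case True
    define k where "k = nat \<lfloor>x * n\<rfloor>"
    have k: "j = k \<longleftrightarrow> x \<in> {real j / n..<(real j + 1) / n}" for j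
    proof -
      have "x \<in> {real j / n..<(real j + 1) / n} \<longleftrightarrow> real j \<le> x * n \<and> x * n < real j + 1"
        using \<open>n > 0\<close> by (auto simp: field_simps)
      also have "\<dots> \<longleftrightarrow> \<lfloor>x * n\<rfloor> = int j" by (simp add: floor_eq_iff)
      also have "\<dots> \<longleftrightarrow> j = k" using True by (auto simp: k_def)
      finally show ?thesis by simp
    qed
    have "x * n < n" using True \<open>n > 0\<close> by simp
    then have "k < n" using True unfolding k_def by (simp add: nat_less_iff floor_less_iff)
    have "(\<Sum>j<n. indicator {real j / n..<(real j + 1) / n} x :: ennreal) = (\<Sum>j<n. if j = k then 1 else 0)"
      by (intro sum.cong) (auto simp: indicator_def k)
    with \<open>k < n\<close> True show ?thesis by simp
  next
    case False
    have "x \<notin> {real j / n..<(real j + 1) / n}" if "j < n" for j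
    proof
      assume x: "x \<in> {real j / n..<(real j + 1) / n}"
      have "0 \<le> real j / n" by simp
      also have "\<dots> \<le> x" using x unfolding atLeastLessThan_iff by blast
      finally have "0 \<le> x" .
      have "x < (real j + 1) / n" using x unfolding atLeastLessThan_iff by blast
      also have "\<dots> \<le> 1" using that by (auto simp: field_simps)
      finally have "x < 1" .
      with \<open>0 \<le> x\<close> False show False by auto
    qed
    then show ?thesis using False by simp
  qed
  have part: "(\<integral>\<^sup>+x. F x * indicator {real j / n..<(real j + 1) / n} x \<partial>lborel)
      = ennreal (1 / real n) * (\<integral>\<^sup>+t. F ((real j + t) / n) * indicator {0..<1} t \<partial>lborel)" for j
  proof -
    have "(\<integral>\<^sup>+x. F x * indicator {real j / n..<(real j + 1) / n} x \<partial>lborel) =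
       ennreal \<bar>1 / real n\<bar> * (\<integral>\<^sup>+t. F (j / n + 1 / n * t) * indicator {real j / n..<(real j + 1) / n} (j / n + 1 / n * t) \<partial>lborel)"
      using \<open>n > 0\<close> by (intro nn_integral_real_affine) auto
    also have "(\<lambda>t. F (j / n + 1 / n * t) * indicator {real j / n..<(real j + 1) / n} (j / n + 1 / n * t))
       = (\<lambda>t. F ((real j + t) / n) * indicator {0..<1} t)"
    proof
      fix t
      have "real j / n + 1 / n * t = (real j + t) / n" by (simp add: add_divide_distrib)
      moreover have "(real j + t) / n \<in> {real j / n..<(real j + 1) / n} \<longleftrightarrow> t \<in> {0..<1}"
        using \<open>n > 0\<close> by (simp add: divide_le_cancel divide_less_cancel)
      ultimately show "F (j / n + 1 / n * t) * indicator {real j / n..<(real j + 1) / n} (j / n + 1 / n * t)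
         = F ((real j + t) / real n) * indicator {0..<1} t"
        unfolding indicator_def by (simp only:)
    qed
    finally show ?thesis by simp
  qed
  have "(\<integral>\<^sup>+x. F x * indicator {0..1} x \<partial>lborel) =
     (\<integral>\<^sup>+x. (\<Sum>j<n. F x * indicator {real j / n..<(real j + 1) / n} x) \<partial>lborel)"
    by (simp add: half_open ind sum_distrib_left)
  also have "\<dots> = (\<Sum>j<n. \<integral>\<^sup>+x. F x * indicator {real j / n..<(real j + 1) / n} x \<partial>lborel)"
    by (rule nn_integral_sum) auto
  also have "\<dots> = ennreal (1 / real n) * (\<Sum>j<n. \<integral>\<^sup>+t. F ((real j + t) / n) * indicator {0..<1} t \<partial>lborel)"
    by (simp add: part sum_distrib_left)
  also have "\<dots> = ennreal (1 / real n) * (\<integral>\<^sup>+t. (\<Sum>j<n. F ((real j + t) / n) * indicator {0..<1} t) \<partial>lborel)"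
    by (subst nn_integral_sum) auto
  finally show ?thesis unfolding half_open by (simp only: sum_distrib_right)
qed

text \<open>The substitution turns the integrand into \<open>c\<close> equal copies, which cancel
  the weight \<open>1 / c\<close>. Since \<open>s < 1 / 2\<close>, the pieces \<open>{0..s}\<close>
  and \<open>{1 - s..1}\<close> near the integers 0 and 1 are disjoint.\<close>

lemma nn_integral_near_int:
  assumes "0 \<le> s" "s < 1 / 2" "c > 0"
  shows "(\<integral>\<^sup>+x. indicator {y. near_int s y} (real c * x) * indicator {0..1} x \<partial>lborel) = ennreal (2 * s)"
proof -
  let ?\<chi> = "indicator {y. near_int s y} :: real \<Rightarrow> ennreal"
  have set_eq: "near_int s t \<and> t \<in> {0..1} \<longleftrightarrow> t \<in> {0..s} \<union> {1 - s..1}" for t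
  proof
    assume *: "near_int s t \<and> t \<in> {0..1}"
    then obtain k :: int where k: "\<bar>t - k\<bar> \<le> s" by (auto simp: near_int_iff)
    then have "real_of_int k < 2" "real_of_int k > -1" using * assms by auto
    then have "k = 0 \<or> k = 1" by linarith
    with k * show "t \<in> {0..s} \<union> {1 - s..1}" by auto
  next
    assume "t \<in> {0..s} \<union> {1 - s..1}"
    then have "\<bar>t - of_int 0\<bar> \<le> s \<or> \<bar>t - of_int 1\<bar> \<le> s" by auto
    moreover have "t \<in> {0..1}" using \<open>t \<in> _ \<union> _\<close> assms by auto
    ultimately show "near_int s t \<and> t \<in> {0..1}" unfolding near_int_iff by blast
  qed
  have "(\<integral>\<^sup>+x. ?\<chi> (real c * x) * indicator {0..1} x \<partial>lborel) =
     ennreal (1 / real c) * (\<integral>\<^sup>+t. (\<Sum>j<c. ?\<chi> (real c * ((real j + t) / real c))) * indicator {0..1} t \<partial>lborel)"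
    using \<open>c > 0\<close> by (intro nn_integral_unit_interval_split) auto
  also have "(\<lambda>t. (\<Sum>j<c. ?\<chi> (real c * ((real j + t) / real c)))) = (\<lambda>t. of_nat c * ?\<chi> t)"
  proof
    fix t
    have "?\<chi> (real c * ((real j + t) / real c)) = ?\<chi> t" for j
      using \<open>c > 0\<close> near_int_add_of_int[of s "int j" t] by (simp add: indicator_def)
    then show "(\<Sum>j<c. ?\<chi> (real c * ((real j + t) / real c))) = of_nat c * ?\<chi> t"
      by (simp only: sum_constant card_lessThan)
  qed
  also have "(\<integral>\<^sup>+t. of_nat c * ?\<chi> t * indicator {0..1} t \<partial>lborel) =
      of_nat c * (\<integral>\<^sup>+t. ?\<chi> t * indicator {0..1} t \<partial>lborel)"
    unfolding mult.assoc by (rule nn_integral_cmult) simp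
  also have "(\<integral>\<^sup>+t. ?\<chi> t * indicator {0..1} t \<partial>lborel) = (\<integral>\<^sup>+t. indicator ({0..s} \<union> {1 - s..1}) t \<partial>lborel)"
  proof -
    have "{y. near_int s y} \<inter> {0..1} = {0..s} \<union> {1 - s..1}" using set_eq by blast
    then show ?thesis by (simp only: indicator_inter_arith[symmetric])
  qed
  also have "\<dots> = emeasure lborel {0..s} + emeasure lborel {1 - s..1}"
    using assms by (subst nn_integral_indicator, simp, subst plus_emeasure) auto
  also have "\<dots> = ennreal (2 * s)"
    using assms by (simp flip: ennreal_plus)
  also have "ennreal (1 / real c) * (of_nat c * ennreal (2 * s)) = ennreal (2 * s)"
    using assms by (simp add: ennreal_of_nat_eq_real_of_nat flip: ennreal_mult)
  finally show ?thesis .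
qed

text \<open>If \<open>a / b = u / v\<close> in lowest terms, this is \<open>1 / max u v\<close>.\<close>

definition gcd_ratio :: "nat \<Rightarrow> nat \<Rightarrow> real" where
  "gcd_ratio a b = real (gcd a b) / real (max a b)"

lemma card_int_interval_le:
  assumes "x \<le> y"
  shows "finite {m::int. x \<le> of_int m \<and> of_int m \<le> y}" "real (card {m::int. x \<le> of_int m \<and> of_int m \<le> y}) \<le> y - x + 1"
proof -
  have "{m::int. x \<le> of_int m \<and> of_int m \<le> y} = {\<lceil>x\<rceil>..\<lfloor>y\<rfloor>}"
    by (auto simp: ceiling_le_iff le_floor_iff)
  then show "finite {m::int. x \<le> of_int m \<and> of_int m \<le> y}"
    "real (card {m::int. x \<le> of_int m \<and> of_int m \<le> y}) \<le> y - x + 1"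
    using assms by (auto, linarith)
qed

text \<open>With \<open>g = gcd c b\<close> and \<open>v = b / g\<close>, the number \<open>c j / b\<close> runs \<open>g\<close> times through all residues \<open>m / v\<close>
  modulo \<open>1\<close>, and an interval of length \<open>2 s v\<close> contains at most \<open>2 s v + 1\<close> integers.\<close>

lemma card_near_int_shifts_le:
  assumes "c > 0" "b > 0" "0 \<le> s"
  shows "real (card {j. j < b \<and> near_int s (real c * ((real j + t) / real b))})
    \<le> 2 * s * real b + real (gcd c b)"
proof -
  define g u v where "g = gcd c b" and "u = c div g" and "v = b div g"
  have g: "g > 0" "c = u * g" "b = v * g" using assms by (auto simp: g_def u_def v_def)
  have cop: "coprime (int u) (int v)" using assms unfolding u_def v_def g_def
    by (metis coprime_int_iff div_gcd_coprime less_numeral_extra(3))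
  have v: "v > 0" using g assms by auto
  define J where "J = {j. j < b \<and> near_int s (real c * ((real j + t) / real b))}"
  define z where "z = real u * t / real v"
  \<comment> \<open>\<open>\<phi> j / v + z\<close> is the signed distance of
    \<open>c * (j + t) / b\<close> to its nearest integer. Since \<open>\<phi> j\<close> is
    congruent to \<open>u * j\<close> modulo \<open>v\<close>, it determines \<open>j\<close> modulo
    \<open>v\<close>, and \<open>j div v\<close> supplies the rest of \<open>j\<close>.\<close>
  define \<phi> where "\<phi> j = int u * int j - int v * round (real u * real j / v + z)" for j
  define I where "I = {m::int. - v * s - v * z \<le> of_int m \<and> of_int m \<le> v * s - v * z}"
  have len: "- v * s - v * z \<le> v * s - v * z" using assms by simp
  have fI: "finite I" and cI: "real (card I) \<le> 2 * v * s + 1"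
    using card_int_interval_le[OF len] by (auto simp: I_def mult_ac)
  have eq: "real c * ((real j + t) / real b) = real u * real j / v + z" for j
    using g v by (simp add: z_def field_simps)
  have "(\<lambda>j. (\<phi> j, j div v)) ` J \<subseteq> I \<times> {..<g}"
  proof (clarify, intro conjI)
    fix j assume "j \<in> J"
    then have j: "j < b" and *: "\<bar>real u * real j / v + z - of_int (round (real u * real j / v + z))\<bar> \<le> s"
      unfolding J_def near_int_def eq by auto
    have "v * \<bar>real u * real j / v + z - of_int (round (real u * real j / v + z))\<bar> \<le> v * s"
      using * by (intro mult_left_mono) auto
    moreover have "v * \<bar>real u * real j / v + z - of_int (round (real u * real j / v + z))\<bar>
       = \<bar>v * (real u * real j / v + z - of_int (round (real u * real j / v + z)))\<bar>"
      by (simp add: abs_mult)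
    moreover have "v * (real u * real j / v + z - of_int (round (real u * real j / v + z))) = of_int (\<phi> j) + v * z"
      using v by (simp add: \<phi>_def field_simps)
    ultimately have "\<bar>of_int (\<phi> j) + v * z\<bar> \<le> v * s" by (simp only:)
    then show "\<phi> j \<in> I" unfolding I_def abs_le_iff mem_Collect_eq by linarith
    show "j div v \<in> {..<g}" using j v g by (simp add: less_mult_imp_div_less mult.commute)
  qed
  moreover have "inj_on (\<lambda>j. (\<phi> j, j div v)) J"
  proof (rule inj_onI)
    fix i j assume "(\<phi> i, i div v) = (\<phi> j, j div v)"
    then have *: "\<phi> i = \<phi> j" "i div v = j div v" by auto
    have "int u * (int i - int j) = int v * (round (real u * real i / v + z) - round (real u * real j / v + z))"
      using *(1) by (simp add: \<phi>_def algebra_simps)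
    then have "int v dvd int u * (int i - int j)" by simp
    then have "int v dvd int i - int j" using cop by (simp add: coprime_dvd_mult_right_iff coprime_commute)
    then have "int i mod int v = int j mod int v" by (simp add: mod_eq_dvd_iff)
    then have "i mod v = j mod v" by (metis of_nat_eq_iff zmod_int)
    with *(2) show "i = j" by (metis div_mult_mod_eq)
  qed
  ultimately have "card J \<le> card (I \<times> {..<g})" using fI by (intro card_inj_on_le) auto
  then have "real (card J) \<le> real (card I) * g"
    by (metis card_cartesian_product card_lessThan of_nat_le_iff of_nat_mult)
  also have "\<dots> \<le> (2 * v * s + 1) * g" using cI by (intro mult_right_mono) auto
  also have "\<dots> = 2 * s * b + g" using g by (simp add: algebra_simps)
  finally show ?thesis unfolding J_def g_def .
qed

text \<open>After the substitution \<open>x = (j + t) / b\<close> the condition on \<open>b x\<close> no longer depends on \<open>j\<close>.\<close>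

lemma nn_integral_near_int_overlap_le:
  assumes "0 \<le> s" "s < 1 / 2" "c > 0" "b > 0"
  shows "(\<integral>\<^sup>+x. indicator {y. near_int s y} (real c * x) * indicator {y. near_int s y} (real b * x)
      * indicator {0..1} x \<partial>lborel) \<le> ennreal (2 * s * (2 * s + real (gcd c b) / real b))"
proof -
  let ?\<chi> = "indicator {y. near_int s y} :: real \<Rightarrow> ennreal"
  have "(\<integral>\<^sup>+x. ?\<chi> (real c * x) * ?\<chi> (real b * x) * indicator {0..1} x \<partial>lborel) =
     ennreal (1 / real b) * (\<integral>\<^sup>+t. (\<Sum>j<b. ?\<chi> (real c * ((real j + t) / real b)) * ?\<chi> (real b * ((real j + t) / real b)))
        * indicator {0..1} t \<partial>lborel)"
    using \<open>b > 0\<close> by (intro nn_integral_unit_interval_split) auto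
  also have "\<dots> \<le> ennreal (1 / real b) * (\<integral>\<^sup>+t. ennreal (2 * s * real b + real (gcd c b)) * (?\<chi> t * indicator {0..1} t) \<partial>lborel)"
  proof (intro mult_left_mono nn_integral_mono)
    fix t
    have "?\<chi> (real b * ((real j + t) / real b)) = ?\<chi> t" for j
      using \<open>b > 0\<close> near_int_add_of_int[of s "int j" t] by (simp add: indicator_def)
    then have "(\<Sum>j<b. ?\<chi> (real c * ((real j + t) / real b)) * ?\<chi> (real b * ((real j + t) / real b)))
       = (\<Sum>j<b. ?\<chi> (real c * ((real j + t) / real b))) * ?\<chi> t"
      by (simp only: sum_distrib_right)
    moreover have "(\<Sum>j<b. ?\<chi> (real c * ((real j + t) / real b))) =
       of_nat (card {j. j < b \<and> near_int s (real c * ((real j + t) / real b))})"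
      by (subst card_eq_sum, subst of_nat_sum, intro sum.mono_neutral_cong_right) (auto simp: indicator_def)
    moreover have "of_nat (card {j. j < b \<and> near_int s (real c * ((real j + t) / real b))})
        \<le> ennreal (2 * s * real b + real (gcd c b))"
      unfolding ennreal_of_nat_eq_real_of_nat using assms by (intro ennreal_leI card_near_int_shifts_le) auto
    ultimately show "(\<Sum>j<b. ?\<chi> (real c * ((real j + t) / real b)) * ?\<chi> (real b * ((real j + t) / real b)))
        * indicator {0..1} t \<le> ennreal (2 * s * real b + real (gcd c b)) * (?\<chi> t * indicator {0..1} t)"
      unfolding mult.assoc[symmetric] by (simp only:) (intro mult_right_mono, auto)
  qed auto
  also have "\<dots> = ennreal (1 / real b) * (ennreal (2 * s * real b + real (gcd c b)) * ennreal (2 * s))"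
    using nn_integral_near_int[of s 1] assms by (simp add: nn_integral_cmult)
  also have "\<dots> = ennreal (2 * s * (2 * s + real (gcd c b) / real b))"
  proof -
    have "1 / real b * ((2 * s * real b + real (gcd c b)) * (2 * s)) = 2 * s * (2 * s + real (gcd c b) / real b)"
      using assms by (simp add: field_simps)
    then show ?thesis using assms by (simp only: ennreal_mult[symmetric] of_nat_0_le_iff zero_le_divide_1_iff
        add_nonneg_nonneg mult_nonneg_nonneg zero_le_numeral)
  qed
  finally show ?thesis .
qed

lemma emeasure_near_int:
  assumes "0 \<le> s" "s < 1 / 2" "c > 0"
  shows "emeasure lborel {x\<in>{0..1}. near_int s (real c * x)} = ennreal (2 * s)"
proof -
  have "emeasure lborel {x\<in>{0..1}. near_int s (real c * x)} = (\<integral>\<^sup>+x. indicator {x\<in>{0..1}. near_int s (real c * x)} x \<partial>lborel)"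
    by (subst nn_integral_indicator) auto
  also have "\<dots> = (\<integral>\<^sup>+x. indicator {y. near_int s y} (real c * x) * indicator {0..1} x \<partial>lborel)"
    by (intro nn_integral_cong) (auto simp: indicator_def)
  finally show ?thesis using nn_integral_near_int[OF assms] by simp
qed

text \<open>The preceding bound has only one of the two numbers in its denominator, but the event is
  symmetric, so the larger one can be put there.\<close>

lemma emeasure_near_int_overlap_le:
  assumes "0 \<le> s" "s < 1 / 2" "c > 0" "b > 0"
  shows "emeasure lborel {x\<in>{0..1}. near_int s (real c * x) \<and> near_int s (real b * x)}
    \<le> ennreal (4 * s\<^sup>2 + 2 * s * gcd_ratio c b)"
proof -
  have *: "emeasure lborel {x\<in>{0..1}. near_int s (real c * x) \<and> near_int s (real b * x)}
    \<le> ennreal (2 * s * (2 * s + real (gcd c b) / real b))" if "c > 0" "b > 0" for c b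
  proof -
    have "emeasure lborel {x\<in>{0..1}. near_int s (real c * x) \<and> near_int s (real b * x)}
       = (\<integral>\<^sup>+x. indicator {x\<in>{0..1}. near_int s (real c * x) \<and> near_int s (real b * x)} x \<partial>lborel)"
      by (subst nn_integral_indicator) auto
    also have "\<dots> = (\<integral>\<^sup>+x. indicator {y. near_int s y} (real c * x) * indicator {y. near_int s y} (real b * x)
      * indicator {0..1} x \<partial>lborel)"
      by (intro nn_integral_cong) (auto simp: indicator_def)
    finally show ?thesis using nn_integral_near_int_overlap_le[OF assms(1,2) that] by simp
  qed
  have "emeasure lborel {x\<in>{0..1}. near_int s (real c * x) \<and> near_int s (real b * x)}
    \<le> ennreal (2 * s * (2 * s + gcd_ratio c b))"
  proof (cases "c \<le> b")
    case True
    then show ?thesis using *[OF assms(3,4)] by (simp add: gcd_ratio_def max_def)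
  next
    case False
    then show ?thesis using *[OF assms(4,3)]
      by (simp add: gcd_ratio_def max_def gcd.commute conj_commute)
  qed
  then show ?thesis by (simp add: algebra_simps power2_eq_square)
qed

section \<open>The divisor bound\<close>

lemma card_divisors_prime_power_mult_le:
  fixes m :: nat
  assumes "prime p" "m > 0"
  shows "card {d. d dvd p ^ k * m} \<le> (k + 1) * card {d. d dvd m}"
proof -
  have "{d. d dvd p ^ k * m} \<subseteq> (\<lambda>(j, e). p ^ j * e) ` ({..k} \<times> {d. d dvd m})"
  proof
    fix d assume "d \<in> {d. d dvd p ^ k * m}"
    then obtain x y where "d = x * y" "x dvd p ^ k" "y dvd m" by (auto elim: dvd_productE)
    then show "d \<in> (\<lambda>(j, e). p ^ j * e) ` ({..k} \<times> {d. d dvd m})"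
      using divides_primepow_nat[OF assms(1)] by force
  qed
  then have "card {d. d dvd p ^ k * m} \<le> card ({..k} \<times> {d. d dvd m})"
    using assms by (intro surj_card_le) auto
  then show ?thesis by (simp add: card_cartesian_product)
qed

lemma card_divisors_le_powr:
  fixes \<epsilon> :: real
  assumes "\<epsilon> > 0"
  obtains C where "C > 0" "\<And>n::nat. n > 0 \<Longrightarrow> real (card {d. d dvd n}) \<le> C * real n powr \<epsilon>"
proof -
  \<comment> \<open>A factor \<open>p ^ k\<close> contributes \<open>k + 1 \<le> 2 ^ k \<le> p powr (\<epsilon> k)\<close> if \<open>p \<ge> P\<close>, and at most
    \<open>B * p powr (\<epsilon> k)\<close> for the finitely many smaller primes.\<close>
  define P where "P = nat \<lceil>2 powr (1 / \<epsilon>)\<rceil>"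
  have P: "2 \<le> real p powr \<epsilon>" if "p \<ge> P" for p
  proof -
    have "2 powr (1 / \<epsilon>) \<le> real p" using that unfolding P_def by linarith
    then have "(2 powr (1 / \<epsilon>)) powr \<epsilon> \<le> real p powr \<epsilon>" using assms by (intro powr_mono2) auto
    then show ?thesis using assms by (simp add: powr_powr)
  qed
  \<comment> \<open>With \<open>x = \<epsilon> * ln 2\<close> the product
    \<open>(1 + 1 / x) * (1 + k * x)\<close> contains the terms \<open>1\<close> and
    \<open>k\<close>, and
    \<open>1 + k * x \<le> exp (k * x) = 2 powr (\<epsilon> * k)\<close>.\<close>
  define B where "B = 1 + 1 / (\<epsilon> * ln 2)"
  have "B \<ge> 1" using assms by (simp add: B_def)
  have B: "real k + 1 \<le> B * 2 powr (\<epsilon> * real k)" for k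
  proof -
    define x where "x = \<epsilon> * ln 2"
    have "x > 0" using assms by (simp add: x_def)
    then have "real k + 1 \<le> (1 + 1 / x) * (1 + real k * x)" by (simp add: field_simps)
    also have "\<dots> \<le> (1 + 1 / x) * exp (real k * x)"
      using \<open>x > 0\<close> by (intro mult_left_mono exp_ge_add_one_self) auto
    finally show ?thesis by (simp add: B_def powr_def x_def mult_ac)
  qed
  \<comment> \<open>Counting the small primes in the exponent of \<open>B\<close> makes the
    induction work: removing the full power of one prime lowers the count by one if the prime is
    small and leaves it unchanged otherwise.\<close>
  have main: "real (card {d. d dvd n}) \<le> B ^ card {p \<in> prime_factors n. p < P} * real n powr \<epsilon>"
    if "n > 0" for n :: nat
    using that
  proof (induction n rule: less_induct)
    case (less n)
    show ?case
    proof (cases "n = 1")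
      case True
      then show ?thesis by simp
    next
      case False
      then obtain p where p: "prime p" "p dvd n" using prime_factor_nat by blast
      define k where "k = multiplicity p n"
      have "\<not> is_unit p" using p by auto
      obtain m where m: "n = p ^ k * m" "\<not> p dvd m"
        using multiplicity_decompose'[of n p] less.prems \<open>\<not> is_unit p\<close> unfolding k_def by blast
      have "k > 0" using p less.prems by (simp add: k_def prime_multiplicity_gt_zero_iff)
      have "m > 0" using m less.prems by (cases m) auto
      have "p ^ k > 1" using one_less_power[OF prime_gt_1_nat[OF p(1)] \<open>k > 0\<close>] .
      then have "m < n" using m \<open>m > 0\<close> by simp
      have pf: "prime_factors n = insert p (prime_factors m)"
      proof (rule set_eqI)
        fix q
        have "q dvd p ^ k * m \<longleftrightarrow> q = p \<or> q dvd m" if "prime q"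
          using that p(1) \<open>k > 0\<close> by (auto simp: prime_dvd_mult_iff prime_dvd_power_iff primes_dvd_imp_eq)
        then show "q \<in> prime_factors n \<longleftrightarrow> q \<in> insert p (prime_factors m)"
          using p(1) \<open>m > 0\<close> less.prems unfolding m(1) by (auto simp: in_prime_factors_iff)
      qed
      have pm: "p \<notin> prime_factors m" using m by auto
      let ?c = "\<lambda>n. card {q \<in> prime_factors n. q < P}"
      have pk: "(real p powr \<epsilon>) ^ k = real p powr (\<epsilon> * real k)"
        using p by (simp add: powr_powr prime_gt_0_nat flip: powr_realpow)
      have "(real k + 1) * B ^ ?c m \<le> B ^ ?c n * real p powr (\<epsilon> * real k)"
      proof (cases "p < P")
        case True
        then have "{q \<in> prime_factors n. q < P} = insert p {q \<in> prime_factors m. q < P}"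
          using pf by auto
        then have c: "?c n = Suc (?c m)" using pm by simp
        have "2 powr (\<epsilon> * real k) \<le> real p powr (\<epsilon> * real k)"
          using assms prime_ge_2_nat[OF p(1)] by (intro powr_mono2) auto
        then have "real k + 1 \<le> B * real p powr (\<epsilon> * real k)"
          using B[of k] \<open>B \<ge> 1\<close> by (meson mult_left_mono order_trans zero_le_one)
        then have "(real k + 1) * B ^ ?c m \<le> (B * real p powr (\<epsilon> * real k)) * B ^ ?c m"
          using \<open>B \<ge> 1\<close> by (intro mult_right_mono) auto
        then show ?thesis using c by (simp add: mult_ac)
      next
        case False
        then have "{q \<in> prime_factors n. q < P} = {q \<in> prime_factors m. q < P}"
          using pf by auto
        then have c: "?c n = ?c m" by simp
        have "real k + 1 \<le> 2 ^ k" using Suc_leI[OF less_exp[of k]]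
          by (metis of_nat_Suc of_nat_le_iff of_nat_numeral of_nat_power add.commute)
        also have "\<dots> \<le> (real p powr \<epsilon>) ^ k" using P[of p] False by (intro power_mono) auto
        finally show ?thesis using c pk \<open>B \<ge> 1\<close> by (simp add: mult.commute mult_right_mono)
      qed
      note step = this
      have "card {d. d dvd n} \<le> (k + 1) * card {d. d dvd m}"
        using card_divisors_prime_power_mult_le[OF p(1) \<open>m > 0\<close>, of k] by (simp only: m(1)[symmetric])
      from of_nat_mono[OF this]
      have "real (card {d. d dvd n}) \<le> (real k + 1) * real (card {d. d dvd m})"
        by (simp only: of_nat_mult of_nat_add of_nat_1)
      also have "\<dots> \<le> (real k + 1) * (B ^ ?c m * real m powr \<epsilon>)"
        using less.IH[OF \<open>m < n\<close> \<open>m > 0\<close>] by (intro mult_left_mono) auto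
      also have "\<dots> = ((real k + 1) * B ^ ?c m) * real m powr \<epsilon>" by simp
      also have "\<dots> \<le> (B ^ ?c n * real p powr (\<epsilon> * real k)) * real m powr \<epsilon>"
        by (intro mult_right_mono step) auto
      also have "\<dots> = B ^ ?c n * real n powr \<epsilon>"
        proof -
        have "real n powr \<epsilon> = (real p ^ k) powr \<epsilon> * real m powr \<epsilon>"
          using arg_cong[OF m(1), of real] by (simp add: powr_mult)
        also have "(real p ^ k) powr \<epsilon> = real p powr (\<epsilon> * real k)"
          using p(1) by (simp add: powr_powr prime_gt_0_nat mult.commute flip: powr_realpow)
        finally show ?thesis by simp
      qed
      finally show ?thesis .
    qed
  qed
  show ?thesis
  proof
    show "B ^ P > 0" using \<open>B \<ge> 1\<close> by simp
    fix n :: nat assume "n > 0"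
    have "card {p \<in> prime_factors n. p < P} \<le> P"
      by (rule order_trans[OF card_mono[of "{..<P}"]]) auto
    then have "B ^ card {p \<in> prime_factors n. p < P} \<le> B ^ P" using \<open>B \<ge> 1\<close> by (rule power_increasing)
    then show "real (card {d. d dvd n}) \<le> B ^ P * real n powr \<epsilon>"
      using main[OF \<open>n > 0\<close>] by (meson mult_right_mono order_trans powr_ge_zero)
  qed
qed

text \<open>Replacing \<open>gcd u a\<close> by the sum of all common divisors \<open>g\<close> of
  \<open>u\<close> and \<open>a\<close> only increases it. For fixed \<open>g\<close>, writing
  \<open>a = g * b\<close> leaves a part of the harmonic sum.\<close>

lemma sum_gcd_over_le:
  assumes "u > 0"
  shows "(\<Sum>a=1..X. real (gcd u a) / real a) \<le> real (card {d. d dvd u}) * harm X"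
proof -
  have "(\<Sum>a=1..X. real (gcd u a) / real a) \<le> (\<Sum>a=1..X. \<Sum>g | g dvd u. if g dvd a then real g / real a else 0)"
  proof (rule sum_mono)
    fix a assume "a \<in> {1..X}"
    have "(if gcd u a dvd a then real (gcd u a) / real a else 0) \<le> (\<Sum>g | g dvd u. if g dvd a then real g / real a else 0)"
      using assms by (intro member_le_sum) auto
    then show "real (gcd u a) / real a \<le> (\<Sum>g | g dvd u. if g dvd a then real g / real a else 0)" by simp
  qed
  also have "\<dots> = (\<Sum>g | g dvd u. \<Sum>a=1..X. if g dvd a then real g / real a else 0)"
    by (rule sum.swap)
  also have "\<dots> \<le> (\<Sum>g | g dvd u. harm X)"
  proof (rule sum_mono)
    fix g assume "g \<in> {g. g dvd u}"
    then have "g > 0" using assms by (auto intro: Nat.gr0I)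
    have "(\<Sum>a=1..X. if g dvd a then real g / real a else 0) = (\<Sum>a | a \<in> {1..X} \<and> g dvd a. real g / real a)"
      by (subst sum.inter_filter[symmetric]) auto
    also have "\<dots> = (\<Sum>a | a \<in> {1..X} \<and> g dvd a. inverse (real (a div g)))"
      using \<open>g > 0\<close> by (intro sum.cong refl) (auto simp: field_simps)
    also have "\<dots> = (\<Sum>b\<in>(\<lambda>a. a div g) ` {a. a \<in> {1..X} \<and> g dvd a}. inverse (real b))"
      by (subst sum.reindex) (auto simp: inj_on_def dvd_div_eq_iff)
    also have "\<dots> \<le> (\<Sum>b=1..X. inverse (real b))"
      using \<open>g > 0\<close> by (intro sum_mono2) (auto simp: div_greater_zero_iff dvd_imp_le Suc_le_eq intro: order_trans[OF div_le_dividend])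
    finally show "(\<Sum>a=1..X. if g dvd a then real g / real a else 0) \<le> harm X" by (simp add: harm_def)
  qed
  finally show ?thesis by simp
qed

section \<open>GCD sums\<close>

text \<open>If \<open>a / b = u / v\<close> in lowest terms, this is \<open>1 / sqrt (u v)\<close>, cut off at \<open>max u v \<le> X\<close>.\<close>

definition gcd_kernel :: "nat \<Rightarrow> nat \<Rightarrow> nat \<Rightarrow> real" where
  "gcd_kernel X a b = (if max a b \<le> X * gcd a b then real (gcd a b) / sqrt (real a * real b) else 0)"

lemma gcd_kernel_nonneg: "0 \<le> gcd_kernel X a b"
  by (simp add: gcd_kernel_def)

lemma gcd_kernel_commute: "gcd_kernel X a b = gcd_kernel X b a"
  by (simp add: gcd_kernel_def gcd.commute max.commute mult.commute)

text \<open>Both sides depend on the ratio alone, so a kernel entry may be evaluated on any fraction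
  representing it, also on one that is not in lowest terms.\<close>

lemma gcd_div_sqrt_scale:
  fixes c e p q :: nat
  assumes "c > 0" "e > 0" "p > 0" "q > 0" "c * q = e * p"
  shows "real (gcd c e) / sqrt (real c * real e) = real (gcd p q) / sqrt (real p * real q)"
proof -
  have "gcd c e * q = e * gcd p q"
    using assms(5) by (metis gcd_mult_distrib_nat mult.commute)
  then have *: "real (gcd c e) * q = e * real (gcd p q)" by (metis of_nat_mult)
  have cq: "real c * q = real e * p" using assms(5) by (metis of_nat_mult)
  have "sqrt (real c * real e) * q = sqrt ((real c * q) * (real e * q))"
    by (simp add: real_sqrt_mult mult_ac)
  also have "\<dots> = e * sqrt (real p * real q)" unfolding cq
    by (simp add: real_sqrt_mult mult_ac)
  finally have "sqrt (real c * real e) * q = e * sqrt (real p * real q)" .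
  with * have "real (gcd c e) * q / (sqrt (real c * real e) * q) = e * real (gcd p q) / (e * sqrt (real p * real q))"
    by (simp only:)
  then show ?thesis using assms by simp
qed

text \<open>Here \<open>c / c' = u / v\<close> and \<open>e / c' = A / B\<close> in lowest terms, so \<open>c / e = (u B) / (v A)\<close>, where
  cancellation removes at most \<open>gcd u A * gcd v B\<close>.\<close>

lemma gcd_kernel_mult_le:
  assumes pos: "c > 0" "c' > 0" "e > 0"
    and supp: "max c e \<le> X * gcd c e" "max e c' \<le> X * gcd e c'"
  defines "u \<equiv> c div gcd c c'" and "v \<equiv> c' div gcd c c'"
    and "A \<equiv> e div gcd e c'" and "B \<equiv> c' div gcd e c'"
  shows "A \<in> {1..X}" "B \<in> {1..X}" "u \<in> {1..X\<^sup>2}" "v \<in> {1..X\<^sup>2}"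
    "gcd_kernel X c e * gcd_kernel X e c' \<le>
       gcd_kernel (X\<^sup>2) c c' * ((real (gcd u A) / real A) * (real (gcd v B) / real B))"
proof -
  define g h G n d where "g = gcd c c'" and "h = gcd e c'" and "G = gcd c e"
    and "n = c div G" and "d = e div G"
  have gpos: "g > 0" "h > 0" "G > 0" using pos by (auto simp: g_def h_def G_def)
  have c: "c = g * u" "c' = g * v" "e = h * A" "c' = h * B" "c = G * n" "e = G * d"
    by (auto simp: u_def v_def A_def B_def g_def h_def n_def d_def G_def)
  have p: "u > 0" "v > 0" "A > 0" "B > 0" "n > 0" "d > 0"
    using pos c by (auto intro!: Nat.gr0I)
  have cop: "coprime u v" "coprime A B"
    using pos div_gcd_coprime[of c c'] div_gcd_coprime[of e c'] by (auto simp: u_def v_def A_def B_def)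
  have "G * n \<le> X * G" "G * d \<le> X * G" "h * A \<le> X * h" "h * B \<le> X * h"
    using supp by (auto simp: c(5)[symmetric] c(6)[symmetric] c(3)[symmetric] c(4)[symmetric] G_def[symmetric] h_def[symmetric])
  then have le: "n \<le> X" "d \<le> X" "A \<le> X" "B \<le> X" using gpos by auto
  show A: "A \<in> {1..X}" and B: "B \<in> {1..X}" using le p by auto
  \<comment> \<open>Both \<open>u / v\<close> and \<open>(n * A) / (d * B)\<close> equal
    \<open>c / c'\<close>, and the first is in lowest terms. Hence \<open>u\<close> divides
    \<open>n * A\<close> and \<open>v\<close> divides \<open>d * B\<close>, which is why the cut-off
    becomes \<open>X^2\<close>.\<close>
  have "g * h * (u * d * B) = c * d * c'" using c(1,4) by (metis mult.assoc mult.commute)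
  also have "\<dots> = n * e * c'" using c(5,6) by (metis mult.assoc mult.commute)
  also have "\<dots> = g * h * (n * A * v)" using c(2,3) by (metis mult.assoc mult.commute)
  finally have eq: "u * (d * B) = v * (n * A)" using gpos by (simp add: mult_ac)
  then have "u dvd n * A" "v dvd d * B"
    using cop(1) by (metis coprime_dvd_mult_right_iff dvd_triv_left, metis coprime_commute coprime_dvd_mult_right_iff dvd_triv_left)
  then have "u \<le> n * A" "v \<le> d * B" using p by (auto intro!: dvd_imp_le)
  moreover have "n * A \<le> X\<^sup>2" "d * B \<le> X\<^sup>2"
    using le by (auto simp: power2_eq_square intro!: mult_le_mono)
  ultimately show u: "u \<in> {1..X\<^sup>2}" and v: "v \<in> {1..X\<^sup>2}" using p by auto
  have k2: "gcd_kernel X e c' = 1 / sqrt (real A * real B)"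
  proof -
    have "gcd A B = 1" using cop by simp
    moreover have "e * B = c' * A" using c(3,4) by (metis mult.assoc mult.commute)
    ultimately show ?thesis
      using gcd_div_sqrt_scale[of e c' A B] pos p supp(2) by (simp add: gcd_kernel_def)
  qed
  have k3: "gcd_kernel (X\<^sup>2) c c' = 1 / sqrt (real u * real v)"
  proof -
    have "gcd u v = 1" using cop by simp
    moreover have "c * v = c' * u" using c(1,2) by (metis mult.assoc mult.commute)
    moreover have "max c c' \<le> X\<^sup>2 * g"
    proof -
      have "g * u \<le> X\<^sup>2 * g \<and> g * v \<le> X\<^sup>2 * g" using u v by (simp add: mult.commute)
      then have "c \<le> X\<^sup>2 * g \<and> c' \<le> X\<^sup>2 * g" by (simp only: c(1,2)[symmetric])
      then show ?thesis by simp
    qed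
    ultimately show ?thesis
      using gcd_div_sqrt_scale[of c c' u v] pos p by (simp add: gcd_kernel_def g_def)
  qed
  have k1: "gcd_kernel X c e = real (gcd (u * B) (v * A)) / sqrt (real (u * B) * real (v * A))"
  proof -
    have "c * (v * A) = g * v * u * A" using c(1) by simp
    also have "\<dots> = h * B * u * A" using c(2,4) by simp
    also have "\<dots> = e * (u * B)" using c(3) by simp
    finally show ?thesis
      using gcd_div_sqrt_scale[of c e "u * B" "v * A"] pos p supp(1) by (simp add: gcd_kernel_def)
  qed
  have "gcd (u * B) (v * A) dvd gcd u (v * A) * gcd B (v * A)"
  proof -
    obtain a b where ab: "gcd (u * B) (v * A) = a * b" "a dvd u" "b dvd B"
      using dvd_productE[OF gcd_dvd1[of "u * B" "v * A"]] by blast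
    then have "a dvd v * A" "b dvd v * A"
      by (metis dvd_mult_left gcd_dvd2, metis dvd_mult_right gcd_dvd2 ab(1))
    with ab show ?thesis by (metis gcd_greatest mult_dvd_mono)
  qed
  moreover have "gcd u (v * A) = gcd u A"
    using cop(1) by (rule gcd_mult_right_left_cancel)
  moreover have "gcd B (v * A) = gcd v B"
    using gcd_mult_right_right_cancel[of B A v] cop(2) by (simp add: coprime_commute gcd.commute)
  ultimately have "gcd (u * B) (v * A) \<le> gcd u A * gcd v B"
    using p by (intro dvd_imp_le) auto
  then have G: "real (gcd (u * B) (v * A)) \<le> real (gcd u A) * real (gcd v B)"
    by (metis of_nat_le_iff of_nat_mult)
  \<comment> \<open>Each kernel entry contributes one factor \<open>sqrt (A * B)\<close> to the
    denominator. Their product is the full \<open>A * B\<close>, so that summing over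
    \<open>A\<close> and \<open>B\<close> gives harmonic sums.\<close>
  have "sqrt (real A * real B) * sqrt (real A * real B) = real A * real B" by simp
  then have "gcd_kernel X c e * gcd_kernel X e c' =
     real (gcd (u * B) (v * A)) / (sqrt (real u * real v) * (real A * real B))"
    unfolding k1 k2 by (simp add: real_sqrt_mult mult_ac)
  also have "\<dots> \<le> (real (gcd u A) * real (gcd v B)) / (sqrt (real u * real v) * (real A * real B))"
    using G by (intro divide_right_mono) auto
  finally show "gcd_kernel X c e * gcd_kernel X e c' \<le>
       gcd_kernel (X\<^sup>2) c c' * ((real (gcd u A) / real A) * (real (gcd v B) / real B))"
    unfolding k3 by (simp add: mult_ac)
qed

text \<open>For fixed \<open>c'\<close> the number \<open>e\<close> is determined by the reduced
  fraction \<open>A / B\<close> of \<open>e / c'\<close>. The sum over \<open>e\<close> is therefore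
  at most a sum over all pairs \<open>A\<close>, \<open>B\<close> up to \<open>X\<close>, which
  splits into two sums of the type \<open>sum_gcd_over_le\<close>.\<close>

lemma gcd_kernel_convolution_le:
  assumes "finite T" "\<And>e. e \<in> T \<Longrightarrow> e > 0" "c > 0" "c' > 0"
    and M: "\<And>u. u \<in> {1..X\<^sup>2} \<Longrightarrow> real (card {d. d dvd u}) \<le> M"
  shows "(\<Sum>e\<in>T. gcd_kernel X c e * gcd_kernel X e c') \<le> gcd_kernel (X\<^sup>2) c c' * (M * harm X)\<^sup>2"
proof -
  define T' where "T' = {e \<in> T. max c e \<le> X * gcd c e \<and> max e c' \<le> X * gcd e c'}"
  define u v where "u = c div gcd c c'" and "v = c' div gcd c c'"
  define \<alpha> where "\<alpha> a = real (gcd u a) / real a" for a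
  define \<beta> where "\<beta> b = real (gcd v b) / real b" for b
  have "finite T'" using assms by (simp add: T'_def)
  have "(\<Sum>e\<in>T. gcd_kernel X c e * gcd_kernel X e c') = (\<Sum>e\<in>T'. gcd_kernel X c e * gcd_kernel X e c')"
    using assms by (intro sum.mono_neutral_right) (auto simp: T'_def gcd_kernel_def)
  also have "\<dots> \<le> gcd_kernel (X\<^sup>2) c c' * (M * harm X)\<^sup>2"
  proof (cases "T' = {}")
    case True
    then show ?thesis by (simp add: gcd_kernel_nonneg)
  next
    case False
    \<comment> \<open>A single contributing \<open>e0\<close> already forces \<open>u\<close> and
      \<open>v\<close> below \<open>X^2\<close>, the range in which \<open>M\<close> bounds the
      number of divisors.\<close>
    then obtain e0 where "e0 \<in> T'" by blast
    then have uv: "u \<in> {1..X\<^sup>2}" "v \<in> {1..X\<^sup>2}"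
      using gcd_kernel_mult_le(3,4)[of c c' e0 X] assms by (auto simp: T'_def u_def v_def)
    have inj: "inj_on (\<lambda>e. (e div gcd e c', c' div gcd e c')) T'"
    proof (rule inj_onI)
      fix e f assume ef: "e \<in> T'" "f \<in> T'"
        "(e div gcd e c', c' div gcd e c') = (f div gcd f c', c' div gcd f c')"
      have "c' = gcd e c' * (c' div gcd e c')" "c' = gcd f c' * (c' div gcd f c')" by auto
      then have "gcd e c' = gcd f c'" using ef \<open>c' > 0\<close>
        by (metis Pair_inject mult_cancel2 mult_0_right less_numeral_extra(3))
      moreover have "e = gcd e c' * (e div gcd e c')" "f = gcd f c' * (f div gcd f c')" by auto
      ultimately show "e = f" using ef by (metis Pair_inject)
    qed
    have "(\<Sum>e\<in>T'. gcd_kernel X c e * gcd_kernel X e c')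
      \<le> (\<Sum>e\<in>T'. gcd_kernel (X\<^sup>2) c c' * (\<alpha> (e div gcd e c') * \<beta> (c' div gcd e c')))"
      using assms unfolding \<alpha>_def \<beta>_def u_def v_def
      by (intro sum_mono gcd_kernel_mult_le(5)) (auto simp: T'_def)
    also have "\<dots> = gcd_kernel (X\<^sup>2) c c' * (\<Sum>(a, b)\<in>(\<lambda>e. (e div gcd e c', c' div gcd e c')) ` T'. \<alpha> a * \<beta> b)"
      by (subst sum.reindex[OF inj]) (simp add: sum_distrib_left)
    also have "\<dots> \<le> gcd_kernel (X\<^sup>2) c c' * (\<Sum>(a, b)\<in>{1..X} \<times> {1..X}. \<alpha> a * \<beta> b)"
    proof (intro mult_left_mono sum_mono2)
      show "(\<lambda>e. (e div gcd e c', c' div gcd e c')) ` T' \<subseteq> {1..X} \<times> {1..X}"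
        using gcd_kernel_mult_le(1,2)[of c c' _ X] assms by (fastforce simp: T'_def)
    qed (auto simp: \<alpha>_def \<beta>_def gcd_kernel_nonneg)
    also have "(\<Sum>(a, b)\<in>{1..X} \<times> {1..X}. \<alpha> a * \<beta> b) = (\<Sum>a=1..X. \<alpha> a) * (\<Sum>b=1..X. \<beta> b)"
      by (simp add: sum_product sum.cartesian_product)
    also have "\<dots> \<le> (M * harm X) * (M * harm X)"
    proof (intro mult_mono)
      have *: "real (card {d. d dvd w}) * harm X \<le> M * harm X" if "w \<in> {1..X\<^sup>2}" for w
        using M[OF that] by (intro mult_right_mono harm_nonneg)
      show 1: "(\<Sum>a=1..X. \<alpha> a) \<le> M * harm X" unfolding \<alpha>_def
        using order_trans[OF sum_gcd_over_le *] uv by auto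
      show "(\<Sum>b=1..X. \<beta> b) \<le> M * harm X" unfolding \<beta>_def
        using order_trans[OF sum_gcd_over_le *] uv by auto
      have "0 \<le> (\<Sum>a=1..X. \<alpha> a)" by (auto simp: \<alpha>_def intro!: sum_nonneg)
      with 1 show "0 \<le> M * harm X" by linarith
      show "0 \<le> (\<Sum>b=1..X. \<beta> b)" by (auto simp: \<beta>_def intro!: sum_nonneg)
    qed
    finally show ?thesis by (simp add: power2_eq_square gcd_kernel_nonneg mult_left_mono)
  qed
  finally show ?thesis .
qed

section \<open>Powers of the kernel on vectors of positive integers\<close>

definition vec_kernel :: "'i set \<Rightarrow> nat \<Rightarrow> ('i \<Rightarrow> nat) \<Rightarrow> ('i \<Rightarrow> nat) \<Rightarrow> real" where
  "vec_kernel I X x y = (\<Prod>i\<in>I. gcd_kernel X (x i) (y i))"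

text \<open>Enlarging \<open>S\<close> to the product of its coordinate projections makes the sum
  over \<open>z\<close> factor. The one-dimensional bound holds for every finite set of positive
  integers, so the size of this product does not matter.\<close>

lemma vec_kernel_convolution_le:
  assumes "finite I" "finite S" "S \<subseteq> PiE I (\<lambda>_. {1..})" "x \<in> S" "y \<in> S"
    and M: "\<And>u. u \<in> {1..X\<^sup>2} \<Longrightarrow> real (card {d. d dvd u}) \<le> M"
  shows "(\<Sum>z\<in>S. vec_kernel I X x z * vec_kernel I X z y) \<le> vec_kernel I (X\<^sup>2) x y * (M * harm X) ^ (2 * card I)"
proof -
  define T where "T i = (\<lambda>z. z i) ` S" for i
  have S: "S \<subseteq> PiE I T" using assms(3) by (auto simp: T_def PiE_def Pi_def extensional_def)
  have finT: "finite (T i)" for i using assms by (simp add: T_def)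
  have pos: "z i > 0" if "z \<in> S" "i \<in> I" for z i
    using that assms(3) by (force simp: PiE_def Pi_def)
  have "(\<Sum>z\<in>S. vec_kernel I X x z * vec_kernel I X z y)
     \<le> (\<Sum>z\<in>PiE I T. \<Prod>i\<in>I. gcd_kernel X (x i) (z i) * gcd_kernel X (z i) (y i))"
    unfolding vec_kernel_def prod.distrib[symmetric] using S finT assms(1)
    by (intro sum_mono2 finite_PiE) (auto intro!: prod_nonneg mult_nonneg_nonneg gcd_kernel_nonneg)
  also have "\<dots> = (\<Prod>i\<in>I. \<Sum>e\<in>T i. gcd_kernel X (x i) e * gcd_kernel X e (y i))"
    by (rule prod_sum_PiE[symmetric]) (use assms finT in auto)
  also have "\<dots> \<le> (\<Prod>i\<in>I. gcd_kernel (X\<^sup>2) (x i) (y i) * (M * harm X)\<^sup>2)"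
  proof (intro prod_mono conjI)
    fix i assume "i \<in> I"
    show "0 \<le> (\<Sum>e\<in>T i. gcd_kernel X (x i) e * gcd_kernel X e (y i))"
      by (intro sum_nonneg mult_nonneg_nonneg gcd_kernel_nonneg)
    show "(\<Sum>e\<in>T i. gcd_kernel X (x i) e * gcd_kernel X e (y i)) \<le> gcd_kernel (X\<^sup>2) (x i) (y i) * (M * harm X)\<^sup>2"
      using \<open>i \<in> I\<close> pos assms(4,5) finT M by (intro gcd_kernel_convolution_le) (auto simp: T_def)
  qed
  also have "\<dots> = vec_kernel I (X\<^sup>2) x y * (M * harm X) ^ (2 * card I)"
    by (simp add: vec_kernel_def prod.distrib power_mult)
  finally show ?thesis .
qed

lemma vec_kernel_nonneg: "0 \<le> vec_kernel I X x y"
  unfolding vec_kernel_def by (intro prod_nonneg gcd_kernel_nonneg)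

lemma vec_kernel_commute: "vec_kernel I X x y = vec_kernel I X y x"
  unfolding vec_kernel_def by (intro prod.cong gcd_kernel_commute refl)

text \<open>The \<open>2 ^ j\<close>-th power of the matrix \<open>vec_kernel\<close> restricted to \<open>S\<close>.\<close>

fun kernel_iter :: "'i set \<Rightarrow> nat \<Rightarrow> ('i \<Rightarrow> nat) set \<Rightarrow> nat \<Rightarrow> ('i \<Rightarrow> nat) \<Rightarrow> ('i \<Rightarrow> nat) \<Rightarrow> real" where
  "kernel_iter I X S 0 x y = vec_kernel I X x y"
| "kernel_iter I X S (Suc j) x y = (\<Sum>z\<in>S. kernel_iter I X S j x z * kernel_iter I X S j z y)"

lemma kernel_iter_nonneg: "0 \<le> kernel_iter I X S j x y"
  by (induction j arbitrary: x y) (auto intro!: sum_nonneg vec_kernel_nonneg)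

lemma kernel_iter_commute: "kernel_iter I X S j x y = kernel_iter I X S j y x"
proof (induction j arbitrary: x y)
  case 0
  then show ?case by (simp add: vec_kernel_commute)
next
  case (Suc j)
  have "kernel_iter I X S j x z * kernel_iter I X S j z y = kernel_iter I X S j y z * kernel_iter I X S j z x" for z
    using Suc[of x z] Suc[of z y] by simp
  then show ?case by simp
qed

lemma harm_le_ln:
  assumes "n > 0"
  shows "harm n \<le> 1 + ln (real n)"
proof -
  have "harm (Suc (n - 1)) - ln (real (Suc (n - 1))) \<le> harm (Suc 0) - ln (real (Suc 0))"
    by (rule decseqD[OF decseq_harm_diff_ln]) simp
  then show ?thesis using assms by (simp add: harm_def)
qed

lemma harm_le_powr:
  fixes \<epsilon> :: real
  assumes "\<epsilon> > 0" "n > 0"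
  shows "harm n \<le> (1 + 1 / \<epsilon>) * real n powr \<epsilon>"
proof -
  have "harm n \<le> 1 + ln (real n)" using assms(2) by (rule harm_le_ln)
  also have "\<dots> \<le> real n powr \<epsilon> + real n powr \<epsilon> / \<epsilon>"
    using assms by (intro add_mono ln_powr_bound ge_one_powr_ge_zero) auto
  finally show ?thesis by (simp add: algebra_simps)
qed

text \<open>For fixed \<open>j\<close> the cut-off \<open>(N^2) ^ (2 ^ j)\<close> is a fixed power
  of \<open>N\<close>, so each squaring costs only divisor counts and harmonic numbers, both below
  small powers of \<open>N\<close>. The constant is uniform in \<open>S\<close>, however large its
  entries are.\<close>

lemma kernel_iter_le:
  assumes "finite I" "\<eta> > 0"
  obtains C :: real where "C > 0"
    "\<And>N S x y. \<lbrakk>N \<ge> 1; finite S; S \<subseteq> PiE I (\<lambda>_. {1..}); x \<in> S; y \<in> S\<rbrakk> \<Longrightarrow>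
       kernel_iter I (N\<^sup>2) S j x y \<le> C * real N powr \<eta> * vec_kernel I ((N\<^sup>2) ^ (2 ^ j)) x y"
  using assms(2)
proof (induction j arbitrary: \<eta> thesis)
  case 0
  have "kernel_iter I (N\<^sup>2) S 0 x y \<le> 1 * real N powr \<eta> * vec_kernel I ((N\<^sup>2) ^ (2 ^ 0)) x y"
    if "N \<ge> 1" for N S x y
    using mult_right_mono[OF _ vec_kernel_nonneg, of 1 "real N powr \<eta>"] ge_one_powr_ge_zero[of "real N" \<eta>] that 0(2)
    by simp
  then show ?case using 0(1)[of 1] by simp
next
  case (Suc j)
  define p where "p = 2 * (2::nat) ^ j"
  \<comment> \<open>With \<open>X = N ^ p\<close>, the divisor bound up to \<open>X^2\<close> and
    \<open>harm X\<close> together cost \<open>N powr (3 * p * \<epsilon>)\<close>. The power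
    \<open>2 * card I\<close> of this is at most \<open>N powr (\<eta> / 2)\<close>; the other half
    of \<open>\<eta>\<close> goes to the two factors with \<open>\<eta> / 4\<close> from the
    induction hypothesis. Adding 1 to \<open>card I\<close> keeps the denominator positive for empty
    \<open>I\<close>.\<close>
  define \<epsilon> where "\<epsilon> = \<eta> / (12 * real p * (real (card I) + 1))"
  have "p > 0" by (simp add: p_def)
  then have "\<epsilon> > 0" using Suc.prems by (simp add: \<epsilon>_def)
  obtain C0 where C0: "C0 > 0"
    "\<And>N S x y. \<lbrakk>N \<ge> 1; finite S; S \<subseteq> PiE I (\<lambda>_. {1..}); x \<in> S; y \<in> S\<rbrakk> \<Longrightarrow>
       kernel_iter I (N\<^sup>2) S j x y \<le> C0 * real N powr (\<eta> / 4) * vec_kernel I ((N\<^sup>2) ^ (2 ^ j)) x y"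
    using Suc.IH[of "\<eta> / 4"] Suc.prems(2) by (metis divide_pos_pos zero_less_numeral)
  obtain C1 where C1: "C1 > 0" "\<And>n::nat. n > 0 \<Longrightarrow> real (card {d. d dvd n}) \<le> C1 * real n powr \<epsilon>"
    using card_divisors_le_powr[OF \<open>\<epsilon> > 0\<close>] by blast
  define C2 where "C2 = C1 * (1 + 1 / \<epsilon>)"
  have "C2 > 0" using C1(1) \<open>\<epsilon> > 0\<close> by (simp add: C2_def add_pos_pos)
  show ?case
  proof (rule Suc.prems(1))
    show "C0\<^sup>2 * C2 ^ (2 * card I) > 0" using C0 \<open>C2 > 0\<close> by simp
    fix N :: nat and S :: "('a \<Rightarrow> nat) set" and x y
    assume N: "N \<ge> 1" and S: "finite S" "S \<subseteq> PiE I (\<lambda>_. {1..})" "x \<in> S" "y \<in> S"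
    define X where "X = (N\<^sup>2) ^ (2 ^ j)"
    have X: "X = N ^ p" by (simp add: X_def p_def power_mult)
    have "X > 0" using N by (simp add: X)
    define M where "M = C1 * real (X\<^sup>2) powr \<epsilon>"
    have M: "real (card {d. d dvd u}) \<le> M" if "u \<in> {1..X\<^sup>2}" for u
    proof -
      have "real (card {d. d dvd u}) \<le> C1 * real u powr \<epsilon>" using C1(2) that by auto
      also have "\<dots> \<le> M" unfolding M_def using that C1(1) \<open>\<epsilon> > 0\<close>
        by (intro mult_left_mono powr_mono2) (auto simp del: of_nat_power)
      finally show ?thesis .
    qed
    have "M \<ge> 0" using C1 by (simp add: M_def)
    have powN: "real (N ^ k) powr e = real N powr (real k * e)" for k e
      using N by (simp add: powr_powr flip: powr_realpow)
    have "M * harm X \<le> M * ((1 + 1 / \<epsilon>) * real X powr \<epsilon>)"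
      using \<open>M \<ge> 0\<close> \<open>\<epsilon> > 0\<close> \<open>X > 0\<close> by (intro mult_left_mono harm_le_powr)
    also have "\<dots> = C2 * (real (N ^ (2 * p)) powr \<epsilon> * real (N ^ p) powr \<epsilon>)"
      unfolding M_def C2_def X by (simp add: power_mult mult_ac)
    also have "\<dots> = C2 * real N powr (3 * real p * \<epsilon>)"
      unfolding powN by (simp add: algebra_simps flip: powr_add)
    finally have "(M * harm X) ^ (2 * card I) \<le> (C2 * real N powr (3 * real p * \<epsilon>)) ^ (2 * card I)"
      using \<open>M \<ge> 0\<close> by (intro power_mono mult_nonneg_nonneg harm_nonneg)
    also have "\<dots> = C2 ^ (2 * card I) * real N powr (3 * real p * \<epsilon> * real (2 * card I))"
      using N by (simp add: power_mult_distrib powr_power mult.commute)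
    also have "\<dots> \<le> C2 ^ (2 * card I) * real N powr (\<eta> / 2)"
    proof (intro mult_left_mono powr_mono)
      have "3 * real p * \<epsilon> * real (2 * card I) \<le> 6 * real p * \<epsilon> * (real (card I) + 1)"
        using \<open>\<epsilon> > 0\<close> by (simp add: algebra_simps)
      also have "\<dots> = \<eta> / 2" using \<open>p > 0\<close> by (simp add: \<epsilon>_def divide_simps)
      finally show "3 * real p * \<epsilon> * real (2 * card I) \<le> \<eta> / 2" .
    qed (use N \<open>C2 > 0\<close> in auto)
    finally have bnd: "(M * harm X) ^ (2 * card I) \<le> C2 ^ (2 * card I) * real N powr (\<eta> / 2)" .
    let ?c = "C0 * real N powr (\<eta> / 4)"
    have c: "?c \<ge> 0" using C0 by simp
    have csq: "?c * ?c = C0\<^sup>2 * real N powr (\<eta> / 2)"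
      using powr_add[of "real N" "\<eta> / 4" "\<eta> / 4"] by (simp add: power2_eq_square)
    have "kernel_iter I (N\<^sup>2) S (Suc j) x y \<le> (\<Sum>z\<in>S. (?c * vec_kernel I X x z) * (?c * vec_kernel I X z y))"
      unfolding kernel_iter.simps X_def using N S c
      by (intro sum_mono mult_mono C0(2) kernel_iter_nonneg mult_nonneg_nonneg vec_kernel_nonneg)
        (use C0(1) in auto)
    also have "\<dots> = (?c * ?c) * (\<Sum>z\<in>S. vec_kernel I X x z * vec_kernel I X z y)"
      by (simp add: sum_distrib_left mult_ac)
    also have "\<dots> \<le> (?c * ?c) * (vec_kernel I (X\<^sup>2) x y * (M * harm X) ^ (2 * card I))"
      using assms S M c by (intro mult_left_mono vec_kernel_convolution_le) auto
    also have "\<dots> \<le> (?c * ?c) * (vec_kernel I (X\<^sup>2) x y * (C2 ^ (2 * card I) * real N powr (\<eta> / 2)))"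
      using c by (intro mult_left_mono bnd vec_kernel_nonneg) auto
    also have "\<dots> = C0\<^sup>2 * C2 ^ (2 * card I) * (real N powr (\<eta> / 2) * real N powr (\<eta> / 2)) * vec_kernel I (X\<^sup>2) x y"
      unfolding csq by (simp add: mult_ac)
    also have "real N powr (\<eta> / 2) * real N powr (\<eta> / 2) = real N powr \<eta>"
      by (simp flip: powr_add)
    also have "X\<^sup>2 = (N\<^sup>2) ^ (2 ^ Suc j)" unfolding X_def by (simp only: power_mult[symmetric] power_Suc mult.commute)
    finally show "kernel_iter I (N\<^sup>2) S (Suc j) x y
        \<le> C0\<^sup>2 * C2 ^ (2 * card I) * real N powr \<eta> * vec_kernel I ((N\<^sup>2) ^ (2 ^ Suc j)) x y" .
  qed
qed

text \<open>Cauchy-Schwarz for the vectors \<open>r\<close> and \<open>K r\<close>: by symmetry of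
  \<open>K\<close> the squared norm of \<open>K r\<close> is the quadratic form of the square of
  \<open>K\<close>.\<close>

lemma quadratic_form_square_le:
  fixes K :: "'a \<Rightarrow> 'a \<Rightarrow> real"
  assumes sym: "\<And>x y. K x y = K y x"
  shows "(\<Sum>x\<in>S. \<Sum>y\<in>S. r x * r y * K x y)\<^sup>2
     \<le> (\<Sum>x\<in>S. (r x)\<^sup>2) * (\<Sum>x\<in>S. \<Sum>y\<in>S. r x * r y * (\<Sum>z\<in>S. K x z * K z y))"
proof -
  define w where "w z = (\<Sum>y\<in>S. r y * K z y)" for z
  have "(\<Sum>x\<in>S. \<Sum>y\<in>S. r x * r y * K x y) = (\<Sum>x\<in>S. r x * w x)"
    by (simp add: w_def sum_distrib_left mult_ac)
  then have "(\<Sum>x\<in>S. \<Sum>y\<in>S. r x * r y * K x y)\<^sup>2 \<le> (\<Sum>x\<in>S. (r x)\<^sup>2) * (\<Sum>z\<in>S. (w z)\<^sup>2)"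
    by (simp add: Cauchy_Schwarz_ineq_sum)
  also have "(\<Sum>z\<in>S. (w z)\<^sup>2) = (\<Sum>z\<in>S. \<Sum>x\<in>S. \<Sum>y\<in>S. r x * r y * (K x z * K z y))"
    unfolding w_def power2_eq_square sum_product using sym by (intro sum.cong refl) (simp add: mult_ac)
  also have "\<dots> = (\<Sum>x\<in>S. \<Sum>z\<in>S. \<Sum>y\<in>S. r x * r y * (K x z * K z y))"
    by (rule sum.swap)
  also have "\<dots> = (\<Sum>x\<in>S. \<Sum>y\<in>S. \<Sum>z\<in>S. r x * r y * (K x z * K z y))"
    by (intro sum.cong refl sum.swap)
  finally show ?thesis by (simp add: sum_distrib_left)
qed

lemma gcd_kernel_le_1: "a > 0 \<Longrightarrow> b > 0 \<Longrightarrow> gcd_kernel X a b \<le> 1"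
proof -
  assume "a > 0" "b > 0"
  then have "real (gcd a b) * real (gcd a b) \<le> real a * real b"
    by (intro mult_mono) (auto intro!: of_nat_mono)
  then have "real (gcd a b) \<le> sqrt (real a * real b)" by (intro real_le_rsqrt) (simp add: power2_eq_square)
  then show ?thesis using \<open>a > 0\<close> \<open>b > 0\<close> by (simp add: gcd_kernel_def)
qed

text \<open>Iterating \<open>quadratic_form_square_le\<close> bounds the quadratic form of the matrix by that of its
  \<open>2 ^ j\<close>-th power. The trivial bound for the latter loses only a fixed power of \<open>N\<close>, which the
  \<open>2 ^ j\<close>-th root makes smaller than \<open>N powr \<epsilon>\<close>.\<close>

lemma gcd_kernel_form_le:
  fixes \<epsilon> :: real
  assumes "finite I" "\<epsilon> > 0"
  obtains C where "C > 0"
    "\<And>N S (r :: ('i \<Rightarrow> nat) \<Rightarrow> real). \<lbrakk>N \<ge> 1; finite S; S \<subseteq> PiE I (\<lambda>_. {1..}); card S \<le> N\<^sup>2; \<And>x. x \<in> S \<Longrightarrow> r x > 0\<rbrakk> \<Longrightarrow>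
       (\<Sum>x\<in>S. \<Sum>y\<in>S. r x * r y * vec_kernel I (N\<^sup>2) x y) \<le> C * real N powr \<epsilon> * (\<Sum>x\<in>S. (r x)\<^sup>2)"
proof -
  \<comment> \<open>The trivial bound below loses \<open>N ^ 3\<close>: one factor from
    \<open>kernel_iter_le\<close> with exponent 1 and two from
    \<open>card S \<le> N\<^sup>2\<close>. The choice of \<open>j\<close> makes the
    \<open>2 ^ j\<close>-th root of this at most \<open>N powr \<epsilon>\<close>.\<close>
  obtain j :: nat where j: "3 / \<epsilon> < 2 ^ j"
    using real_arch_pow[of 2 "3 / \<epsilon>"] by auto
  obtain C where C: "C > 0"
    "\<And>N S x y. \<lbrakk>N \<ge> 1; finite S; S \<subseteq> PiE I (\<lambda>_. {1..}); x \<in> S; y \<in> S\<rbrakk> \<Longrightarrow>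
       kernel_iter I (N\<^sup>2) S j x y \<le> C * real N powr 1 * vec_kernel I ((N\<^sup>2) ^ (2 ^ j)) x y"
    using kernel_iter_le[OF assms(1), of 1 j] by (metis zero_less_one)
  show ?thesis
  proof
    show "C powr (1 / 2 ^ j) > 0" using C by simp
    fix N S and r :: "('i \<Rightarrow> nat) \<Rightarrow> real"
    assume N: "N \<ge> 1" and S: "finite S" "S \<subseteq> PiE I (\<lambda>_. {1..})" "card S \<le> N\<^sup>2" and r: "\<And>x. x \<in> S \<Longrightarrow> r x > 0"
    define R where "R = (\<Sum>x\<in>S. (r x)\<^sup>2)"
    define q where "q j = (\<Sum>x\<in>S. \<Sum>y\<in>S. r x * r y * kernel_iter I (N\<^sup>2) S j x y)" for j
    have q0: "q 0 = (\<Sum>x\<in>S. \<Sum>y\<in>S. r x * r y * vec_kernel I (N\<^sup>2) x y)" by (simp add: q_def)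
    have qnn: "q k \<ge> 0" for k unfolding q_def using r
      by (intro sum_nonneg mult_nonneg_nonneg kernel_iter_nonneg) (auto intro: less_imp_le)
    have "q 0 \<le> C powr (1 / 2 ^ j) * real N powr \<epsilon> * R"
    proof (cases "S = {}")
      case True
      then show ?thesis by (simp add: q_def R_def)
    next
      case False
      then have "R > 0" unfolding R_def using S r by (intro sum_pos) fastforce+
      have step: "(q k)\<^sup>2 \<le> R * q (Suc k)" for k
        unfolding q_def R_def kernel_iter.simps by (rule quadratic_form_square_le[OF kernel_iter_commute])
      \<comment> \<open>This is \<open>(q 0 / R) ^ (2 ^ k) \<le> q k / R\<close> with the
        denominators cleared.\<close>
      have iter: "q 0 ^ (2 ^ k) * R \<le> R ^ (2 ^ k) * q k" for k
      proof (induction k)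
        case 0
        then show ?case by simp
      next
        case (Suc k)
        have "(q 0 ^ (2 ^ Suc k) * R) * R = (q 0 ^ (2 ^ k) * R)\<^sup>2"
          by (simp add: power_mult power_mult_distrib power2_eq_square mult_ac power_add mult_2)
        also have "\<dots> \<le> (R ^ (2 ^ k) * q k)\<^sup>2"
          using Suc \<open>R > 0\<close> qnn by (intro power_mono) auto
        also have "\<dots> = R ^ (2 ^ Suc k) * (q k)\<^sup>2"
          by (simp add: power_mult_distrib power2_eq_square power_add mult_2)
        also have "\<dots> \<le> R ^ (2 ^ Suc k) * (R * q (Suc k))"
          using \<open>R > 0\<close> by (intro mult_left_mono step) auto
        finally show ?case using \<open>R > 0\<close> by (simp add: mult_ac)
      qed
      have "vec_kernel I ((N\<^sup>2) ^ (2 ^ j)) x y \<le> 1" if "x \<in> S" "y \<in> S" for x y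
        unfolding vec_kernel_def using that S(2)
        by (intro prod_le_1 conjI gcd_kernel_nonneg gcd_kernel_le_1) (force simp: PiE_def Pi_def)+
      then have kle: "kernel_iter I (N\<^sup>2) S j x y \<le> C * real N" if "x \<in> S" "y \<in> S" for x y
      proof -
        have "C * real N * vec_kernel I ((N\<^sup>2) ^ (2 ^ j)) x y \<le> C * real N * 1"
          using that C(1) \<open>\<And>x y. x \<in> S \<Longrightarrow> y \<in> S \<Longrightarrow> vec_kernel I ((N\<^sup>2) ^ (2 ^ j)) x y \<le> 1\<close>
          by (intro mult_left_mono) auto
        then show ?thesis using C(2)[OF N S(1,2) that] N by simp
      qed
      have "q j \<le> (\<Sum>x\<in>S. \<Sum>y\<in>S. r x * r y * (C * real N))"
        unfolding q_def using r by (intro sum_mono mult_left_mono kle) (auto intro!: mult_nonneg_nonneg intro: less_imp_le)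
      also have "\<dots> = C * real N * (\<Sum>x\<in>S. 1 * r x)\<^sup>2"
        by (simp add: power2_eq_square sum_product sum_distrib_left sum_distrib_right mult_ac)
      also have "\<dots> \<le> C * real N * ((\<Sum>x\<in>S. 1\<^sup>2) * R)"
        unfolding R_def using C N by (intro mult_left_mono Cauchy_Schwarz_ineq_sum) auto
      also have "\<dots> = C * real N * (real (card S) * R)" by simp
      also have "\<dots> \<le> C * real N * (real (N\<^sup>2) * R)"
        using C N S(3) \<open>R > 0\<close> by (intro mult_left_mono mult_right_mono of_nat_mono) auto
      finally have "q j \<le> C * real N ^ 3 * R" by (simp add: power3_eq_cube power2_eq_square mult_ac)
      then have "R ^ (2 ^ j) * q j \<le> R ^ (2 ^ j) * (C * real N ^ 3 * R)"
        using \<open>R > 0\<close> by (intro mult_left_mono) auto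
      with iter[of j] have "q 0 ^ (2 ^ j) * R \<le> R ^ (2 ^ j) * (C * real N ^ 3) * R" by (simp add: mult_ac)
      then have "q 0 ^ (2 ^ j) \<le> R ^ (2 ^ j) * (C * real N ^ 3)" using \<open>R > 0\<close> by simp
      also have "C * real N ^ 3 = ((C * real N ^ 3) powr (1 / 2 ^ j)) ^ (2 ^ j)"
        using C N by (simp add: powr_power)
      finally have "q 0 ^ (2 ^ j) \<le> (R * (C * real N ^ 3) powr (1 / 2 ^ j)) ^ (2 ^ j)"
        by (simp add: power_mult_distrib)
      then have "q 0 \<le> R * (C * real N ^ 3) powr (1 / 2 ^ j)"
        using \<open>R > 0\<close> qnn[of 0] by (subst (asm) power_mono_iff) auto
      also have "(C * real N ^ 3) powr (1 / 2 ^ j) = C powr (1 / 2 ^ j) * (real N powr 3) powr (1 / 2 ^ j)"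
        using C N by (simp add: powr_mult powr_numeral)
      also have "(real N powr 3) powr (1 / 2 ^ j) = real N powr (3 / 2 ^ j)" by (simp add: powr_powr del: powr_numeral)
      also have "R * (C powr (1 / 2 ^ j) * real N powr (3 / 2 ^ j)) \<le> R * (C powr (1 / 2 ^ j) * real N powr \<epsilon>)"
        using j \<open>R > 0\<close> N assms(2) by (intro mult_left_mono powr_mono) (auto simp: field_simps)
      finally show ?thesis by (simp add: mult_ac)
    qed
    then show "(\<Sum>x\<in>S. \<Sum>y\<in>S. r x * r y * vec_kernel I (N\<^sup>2) x y) \<le> C powr (1 / 2 ^ j) * real N powr \<epsilon> * (\<Sum>x\<in>S. (r x)\<^sup>2)"
      by (simp only: q0 R_def)
  qed
qed

section \<open>From the kernel to sums of products of gcd ratios\<close>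

lemma sum_over_fibres:
  fixes f :: "'b \<Rightarrow> real"
  assumes "finite P"
  shows "(\<Sum>p\<in>P. f (x p)) = (\<Sum>z\<in>x ` P. real (card {p \<in> P. x p = z}) * f z)"
proof -
  have "(\<Sum>p\<in>P. f (x p)) = (\<Sum>z\<in>x ` P. \<Sum>p | p \<in> P \<and> x p = z. f (x p))"
    using assms by (rule sum.image_gen)
  also have "\<dots> = (\<Sum>z\<in>x ` P. real (card {p \<in> P. x p = z}) * f z)"
    by (intro sum.cong refl) simp
  finally show ?thesis .
qed

lemma gcd_ratio_nonneg: "0 \<le> gcd_ratio a b"
  by (simp add: gcd_ratio_def)

lemma gcd_ratio_le_1: "a > 0 \<Longrightarrow> b > 0 \<Longrightarrow> gcd_ratio a b \<le> 1"
  by (simp add: gcd_ratio_def gcd_le1_nat max_def)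

text \<open>If every coordinate respects the cut-off,
  \<open>1 / max u v \<le> 1 / sqrt (u * v)\<close> applies factor by factor. Otherwise one factor
  is below \<open>1 / X\<close> and the others are at most 1.\<close>

lemma prod_gcd_ratio_le:
  assumes "finite I" "X > 0" "\<And>i. i \<in> I \<Longrightarrow> a i > 0" "\<And>i. i \<in> I \<Longrightarrow> b i > 0"
  shows "(\<Prod>i\<in>I. gcd_ratio (a i) (b i)) \<le> vec_kernel I X a b + 1 / real X"
proof (cases "\<forall>i\<in>I. max (a i) (b i) \<le> X * gcd (a i) (b i)")
  case True
  have "gcd_ratio (a i) (b i) \<le> gcd_kernel X (a i) (b i)" if "i \<in> I" for i
  proof -
    have "sqrt (real (a i) * real (b i)) \<le> sqrt (real (max (a i) (b i)) * real (max (a i) (b i)))"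
      by (intro real_sqrt_le_mono mult_mono) auto
    then have "sqrt (real (a i) * real (b i)) \<le> real (max (a i) (b i))" by simp
    then have "gcd_ratio (a i) (b i) \<le> real (gcd (a i) (b i)) / sqrt (real (a i) * real (b i))"
      unfolding gcd_ratio_def using assms(3,4)[OF that] by (intro divide_left_mono) auto
    then show ?thesis using True that by (simp add: gcd_kernel_def)
  qed
  then have "(\<Prod>i\<in>I. gcd_ratio (a i) (b i)) \<le> vec_kernel I X a b"
    unfolding vec_kernel_def by (intro prod_mono) (auto simp: gcd_ratio_nonneg)
  also have "\<dots> \<le> vec_kernel I X a b + 1 / real X" by simp
  finally show ?thesis .
next
  case False
  then obtain i where i: "i \<in> I" "X * gcd (a i) (b i) < max (a i) (b i)" by (auto simp: not_le)
  have "(\<Prod>i\<in>I. gcd_ratio (a i) (b i)) = gcd_ratio (a i) (b i) * (\<Prod>i\<in>I - {i}. gcd_ratio (a i) (b i))"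
    using assms i by (simp add: prod.remove)
  also have "\<dots> \<le> gcd_ratio (a i) (b i) * 1"
    using assms by (intro mult_left_mono prod_le_1) (auto simp: gcd_ratio_nonneg gcd_ratio_le_1)
  also have "\<dots> \<le> 1 / real X"
  proof -
    have "real X * real (gcd (a i) (b i)) \<le> real (max (a i) (b i))"
      using i(2) by (metis less_imp_le of_nat_le_iff of_nat_mult)
    then show ?thesis using assms(2) assms(3)[OF i(1)] by (simp add: gcd_ratio_def field_simps del: of_nat_max)
  qed
  also have "\<dots> \<le> vec_kernel I X a b + 1 / real X" by (simp add: vec_kernel_nonneg)
  finally show ?thesis .
qed

text \<open>Grouping the indices by the vector \<open>c p\<close> restricted to \<open>I\<close>
  turns the sum into a quadratic form in the multiplicities \<open>r\<close>, and the sum of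
  \<open>r^2\<close> counts the coincidences. At most \<open>N^4\<close> pairs lose
  \<open>1 / N^2\<close> each to the cut-off, which gives the term \<open>N^2\<close>.\<close>

lemma sum_prod_gcd_ratio_le:
  fixes \<epsilon> :: real
  assumes "finite I" "\<epsilon> > 0"
  obtains C where "C > 0"
    "\<And>N P (c :: 'p \<Rightarrow> 'i \<Rightarrow> nat). \<lbrakk>N \<ge> 1; finite P; card P \<le> N\<^sup>2; \<And>p i. p \<in> P \<Longrightarrow> i \<in> I \<Longrightarrow> c p i > 0\<rbrakk> \<Longrightarrow>
       (\<Sum>p\<in>P. \<Sum>p'\<in>P. \<Prod>i\<in>I. gcd_ratio (c p i) (c p' i))
         \<le> C * real N powr \<epsilon> * real (card {(p, p'). p \<in> P \<and> p' \<in> P \<and> (\<forall>i\<in>I. c p i = c p' i)}) + (real N)\<^sup>2"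
proof -
  obtain C where C: "C > 0"
    "\<And>N S (r :: ('i \<Rightarrow> nat) \<Rightarrow> real). \<lbrakk>N \<ge> 1; finite S; S \<subseteq> PiE I (\<lambda>_. {1..}); card S \<le> N\<^sup>2; \<And>x. x \<in> S \<Longrightarrow> r x > 0\<rbrakk> \<Longrightarrow>
       (\<Sum>x\<in>S. \<Sum>y\<in>S. r x * r y * vec_kernel I (N\<^sup>2) x y) \<le> C * real N powr \<epsilon> * (\<Sum>x\<in>S. (r x)\<^sup>2)"
    using gcd_kernel_form_le[OF assms] by blast
  show ?thesis
  proof
    fix N P and c :: "'p \<Rightarrow> 'i \<Rightarrow> nat"
    assume N: "N \<ge> 1" and P: "finite P" "card P \<le> N\<^sup>2" and pos: "\<And>p i. p \<in> P \<Longrightarrow> i \<in> I \<Longrightarrow> c p i > 0"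
    define x where "x p = restrict (c p) I" for p
    define S where "S = x ` P"
    define r where "r z = real (card {p \<in> P. x p = z})" for z
    have S: "finite S" "S \<subseteq> PiE I (\<lambda>_. {1..})" "card S \<le> N\<^sup>2"
      using P pos card_image_le[OF P(1), of x] by (auto simp: S_def x_def Suc_le_eq)
    have rpos: "r z > 0" if "z \<in> S" for z
      using that P by (auto simp: r_def S_def card_gt_0_iff)
    have dbl: "(\<Sum>p\<in>P. \<Sum>p'\<in>P. g (x p) (x p')) = (\<Sum>z\<in>S. \<Sum>z'\<in>S. r z * r z' * g z z')"
      for g :: "('i \<Rightarrow> nat) \<Rightarrow> ('i \<Rightarrow> nat) \<Rightarrow> real"
    proof -
      have "(\<Sum>p\<in>P. \<Sum>p'\<in>P. g (x p) (x p')) = (\<Sum>p\<in>P. \<Sum>z'\<in>S. r z' * g (x p) z')"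
        unfolding S_def r_def by (intro sum.cong refl sum_over_fibres P)
      also have "\<dots> = (\<Sum>z\<in>S. r z * (\<Sum>z'\<in>S. r z' * g z z'))"
        unfolding S_def r_def by (rule sum_over_fibres[OF P(1)])
      finally show ?thesis by (simp add: sum_distrib_left mult_ac)
    qed
    have "(\<Sum>z\<in>S. (r z)\<^sup>2) = (\<Sum>z\<in>S. \<Sum>z'\<in>S. r z * r z' * of_bool (z = z'))"
      using S(1) by (intro sum.cong refl) (simp add: power2_eq_square of_bool_def if_distrib[of "(*) _"] cong: if_cong)
    also have "\<dots> = (\<Sum>p\<in>P. \<Sum>p'\<in>P. of_bool (x p = x p'))" by (rule dbl[symmetric])
    also have "\<dots> = (\<Sum>(p, p')\<in>P \<times> P. of_bool (x p = x p'))" by (simp add: sum.cartesian_product)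
    also have "\<dots> = real (card {(p, p'). p \<in> P \<and> p' \<in> P \<and> x p = x p'})"
      using P(1) by (subst card_eq_sum, subst of_nat_sum, intro sum.mono_neutral_cong_right) auto
    also have "{(p, p'). p \<in> P \<and> p' \<in> P \<and> x p = x p'} = {(p, p'). p \<in> P \<and> p' \<in> P \<and> (\<forall>i\<in>I. c p i = c p' i)}"
      unfolding x_def by (auto simp: restrict_def fun_eq_iff)
    finally have diag: "(\<Sum>z\<in>S. (r z)\<^sup>2) = real (card {(p, p'). p \<in> P \<and> p' \<in> P \<and> (\<forall>i\<in>I. c p i = c p' i)})" .
    have "(\<Sum>p\<in>P. \<Sum>p'\<in>P. \<Prod>i\<in>I. gcd_ratio (c p i) (c p' i))
       \<le> (\<Sum>p\<in>P. \<Sum>p'\<in>P. vec_kernel I (N\<^sup>2) (c p) (c p') + 1 / real (N\<^sup>2))"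
      using assms(1) N pos by (intro sum_mono prod_gcd_ratio_le) auto
    also have "\<dots> = (\<Sum>p\<in>P. \<Sum>p'\<in>P. vec_kernel I (N\<^sup>2) (x p) (x p')) + real (card P) * real (card P) / real (N\<^sup>2)"
      by (simp add: sum.distrib vec_kernel_def x_def)
    also have "(\<Sum>p\<in>P. \<Sum>p'\<in>P. vec_kernel I (N\<^sup>2) (x p) (x p')) = (\<Sum>z\<in>S. \<Sum>z'\<in>S. r z * r z' * vec_kernel I (N\<^sup>2) z z')"
      by (rule dbl)
    also have "\<dots> \<le> C * real N powr \<epsilon> * (\<Sum>z\<in>S. (r z)\<^sup>2)"
      using N S rpos by (intro C(2)) auto
    also have "real (card P) * real (card P) / real (N\<^sup>2) \<le> (real N)\<^sup>2"
    proof -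
      have "real (card P) * real (card P) \<le> real (N\<^sup>2) * real (N\<^sup>2)"
        using P(2) by (intro mult_mono of_nat_mono) auto
      then show ?thesis using N by (simp add: field_simps)
    qed
    finally show "(\<Sum>p\<in>P. \<Sum>p'\<in>P. \<Prod>i\<in>I. gcd_ratio (c p i) (c p' i))
         \<le> C * real N powr \<epsilon> * real (card {(p, p'). p \<in> P \<and> p' \<in> P \<and> (\<forall>i\<in>I. c p i = c p' i)}) + (real N)\<^sup>2"
      unfolding diag by simp
  qed (rule C(1))
qed

section \<open>The second moment\<close>

lemma emeasure_lborel_vec_product:
  fixes A :: "'d::finite \<Rightarrow> real set"
  assumes [measurable]: "\<And>i. A i \<in> sets borel"
  shows "emeasure lborel {x :: real ^ 'd. \<forall>i. x $ i \<in> A i} = (\<Prod>i\<in>UNIV. emeasure lborel (A i))"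
proof -
  \<comment> \<open>The product formula for \<open>lborel\<close> is indexed by basis vectors;
    \<open>THE\<close> recovers the coordinate belonging to a basis vector.\<close>
  define f where "f b = (indicator (A (THE i. b = axis i (1 :: real))) :: real \<Rightarrow> ennreal)" for b :: "real ^ 'd"
  have f: "f (axis i 1) = indicator (A i)" for i
    unfolding f_def by (subst the_equality) (auto simp: axis_eq_axis)
  have Basis: "(Basis :: (real ^ 'd) set) = (\<lambda>i. axis i 1) ` UNIV"
    by (auto simp: Basis_vec_def)
  have inj: "inj (\<lambda>i :: 'd. axis i (1 :: real))" by (auto simp: inj_on_def axis_eq_axis)
  have meas: "{x :: real ^ 'd. \<forall>i. x $ i \<in> A i} \<in> sets borel" by measurable
  have ind: "indicator {x :: real ^ 'd. \<forall>i. x $ i \<in> A i} x = (\<Prod>b\<in>Basis. f b (x \<bullet> b))" for x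
  proof -
    have "(\<Prod>b\<in>Basis. f b (x \<bullet> b)) = (\<Prod>i\<in>UNIV. indicator (A i) (x $ i))"
      unfolding Basis by (subst prod.reindex[OF inj]) (simp add: f inner_axis)
    also have "\<dots> = indicator {x :: real ^ 'd. \<forall>i. x $ i \<in> A i} x"
    proof (cases "\<forall>i. x $ i \<in> A i")
      case False
      then obtain i where "x $ i \<notin> A i" by blast
      then show ?thesis by (subst prod_zero) (auto intro!: exI[of _ i] simp: indicator_def)
    qed simp
    finally show ?thesis by simp
  qed
  have "emeasure lborel {x :: real ^ 'd. \<forall>i. x $ i \<in> A i} = (\<integral>\<^sup>+x. (\<Prod>b\<in>Basis. f b (x \<bullet> b)) \<partial>lborel)"
  proof -
    have "emeasure lborel {x :: real ^ 'd. \<forall>i. x $ i \<in> A i} = (\<integral>\<^sup>+x. indicator {x. \<forall>i. x $ i \<in> A i} x \<partial>lborel)"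
      using meas by (intro nn_integral_indicator[symmetric]) simp
    then show ?thesis by (simp only: ind)
  qed
  also have "\<dots> = (\<Prod>b\<in>Basis. \<integral>\<^sup>+x. f b x \<partial>lborel)"
    by (rule nn_integral_lborel_prod) (auto simp: f_def)
  also have "\<dots> = (\<Prod>i\<in>UNIV. emeasure lborel (A i))"
    unfolding Basis by (subst prod.reindex[OF inj]) (simp add: f)
  finally show ?thesis .
qed

definition near_set :: "real \<Rightarrow> ('d::finite \<Rightarrow> nat) \<Rightarrow> (real ^ 'd) set" where
  "near_set s c = {\<alpha> \<in> cbox 0 1. \<forall>i. near_int s (real (c i) * \<alpha> $ i)}"

lemma near_set_eq: "near_set s c = {\<alpha>. \<forall>i. \<alpha> $ i \<in> {x \<in> {0..1}. near_int s (real (c i) * x)}}"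
  by (auto simp: near_set_def mem_box_cart)

lemma near_set_Int_eq:
  "near_set s c \<inter> near_set s b =
     {\<alpha>. \<forall>i. \<alpha> $ i \<in> {x \<in> {0..1}. near_int s (real (c i) * x) \<and> near_int s (real (b i) * x)}}"
  unfolding near_set_eq by auto

lemma sets_near_set [measurable]: "near_set s c \<in> sets borel"
  unfolding near_set_eq by measurable

lemma measure_near_set:
  fixes c :: "'d::finite \<Rightarrow> nat"
  assumes "0 \<le> s" "s < 1 / 2" "\<And>i. c i > 0"
  shows "measure lborel (near_set s c) = (2 * s) ^ CARD('d)"
proof -
  have "emeasure lborel (near_set s c) = (\<Prod>i\<in>(UNIV :: 'd set). ennreal (2 * s))"
    unfolding near_set_eq using assms
    by (subst emeasure_lborel_vec_product, measurable) (intro prod.cong refl emeasure_near_int)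
  also have "\<dots> = ennreal ((2 * s) ^ CARD('d))" using assms by (simp add: ennreal_power)
  finally show ?thesis using assms by (simp add: measure_def)
qed

lemma measure_near_set_Int_le:
  fixes c b :: "'d::finite \<Rightarrow> nat"
  assumes "0 \<le> s" "s < 1 / 2" "\<And>i. c i > 0" "\<And>i. b i > 0"
  shows "measure lborel (near_set s c \<inter> near_set s b) \<le> (\<Prod>i\<in>UNIV. 4 * s\<^sup>2 + 2 * s * gcd_ratio (c i) (b i))"
proof -
  have nn: "0 \<le> 4 * s\<^sup>2 + 2 * s * gcd_ratio (c i) (b i)" for i
    using assms by (simp add: gcd_ratio_nonneg)
  have "emeasure lborel (near_set s c \<inter> near_set s b)
      \<le> (\<Prod>i\<in>UNIV. ennreal (4 * s\<^sup>2 + 2 * s * gcd_ratio (c i) (b i)))"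
    unfolding near_set_Int_eq using assms
    by (subst emeasure_lborel_vec_product, measurable) (intro prod_mono_ennreal emeasure_near_int_overlap_le)
  also have "\<dots> = ennreal (\<Prod>i\<in>UNIV. 4 * s\<^sup>2 + 2 * s * gcd_ratio (c i) (b i))"
    using nn by (simp add: prod_ennreal)
  finally show ?thesis using nn by (simp add: measure_def enn2real_leI prod_nonneg)
qed

lemma emeasure_unit_cbox: "emeasure lborel (cbox 0 (1 :: real ^ 'd::finite)) = 1"
proof -
  have "cbox 0 (1 :: real ^ 'd) = {x. \<forall>i. x $ i \<in> {0..1}}" by (auto simp: mem_box_cart)
  then have "emeasure lborel (cbox 0 (1 :: real ^ 'd)) = (\<Prod>i\<in>(UNIV :: 'd set). emeasure lborel {0..1 :: real})"
    by (simp only:) (intro emeasure_lborel_vec_product, simp)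
  then show ?thesis by simp
qed

text \<open>The means are exact, so the cross term and the square of the mean combine to exactly
  \<open>(4 * s^2)^d\<close> subtracted for each pair. An upper bound for the joint probabilities
  then suffices.\<close>

lemma second_moment_bound:
  fixes c :: "'p \<Rightarrow> 'd::finite \<Rightarrow> nat"
  assumes s: "0 \<le> s" "s < 1 / 2" and P: "finite P" and pos: "\<And>p i. p \<in> P \<Longrightarrow> c p i > 0"
  shows "measure lborel (cbox 0 1 - (\<Union>p\<in>P. near_set s (c p))) * (real (card P) * (2 * s) ^ CARD('d))\<^sup>2
    \<le> (\<Sum>p\<in>P. \<Sum>q\<in>P. (\<Prod>i\<in>UNIV. 4 * s\<^sup>2 + 2 * s * gcd_ratio (c p i) (c q i)) - (4 * s\<^sup>2) ^ CARD('d))"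
proof -
  define B where "B p = near_set s (c p)" for p
  define M where "M = real (card P) * (2 * s) ^ CARD('d)"
  define U where "U = cbox 0 (1 :: real ^ 'd)"
  define Z where "Z = U - (\<Union>p\<in>P. B p)"
  have BU: "B p \<subseteq> U" for p by (auto simp: B_def near_set_def U_def)
  have [measurable]: "U \<in> sets borel" by (simp add: U_def)
  have [measurable]: "B p \<in> sets borel" for p by (simp add: B_def)
  have [measurable]: "Z \<in> sets borel"
  proof -
    have "(\<Union>p\<in>P. B p) \<in> sets borel" using P by (rule sets.finite_UN) measurable
    then show ?thesis unfolding Z_def by (rule sets.Diff[OF \<open>U \<in> sets borel\<close>])
  qed
  have U1: "emeasure lborel U = 1" unfolding U_def by (rule emeasure_unit_cbox)
  have int: "integrable lborel (indicator A :: _ \<Rightarrow> real)" if "A \<subseteq> U" "A \<in> sets borel" for A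
  proof -
    have "emeasure lborel A \<le> 1" using emeasure_mono[OF that(1), of lborel] U1 by simp
    then have "emeasure lborel A < \<infinity>" using le_less_trans by fastforce
    then show ?thesis using that(2) by (auto intro!: integrable_real_indicator)
  qed
  have intB: "integrable lborel (indicator (B p) :: _ \<Rightarrow> real)" for p by (rule int[OF BU]) simp
  have intBB: "integrable lborel (indicator (B p \<inter> B q) :: _ \<Rightarrow> real)" for p q
    using BU by (intro int) auto
  have intU: "integrable lborel (indicator U :: _ \<Rightarrow> real)" by (intro int) auto
  have intZ: "integrable lborel (indicator Z :: _ \<Rightarrow> real)" by (intro int \<open>Z \<in> sets borel\<close>) (simp add: Z_def)
  \<comment> \<open>The expansion of \<open>(f - M)^2\<close> on the cube, where \<open>f\<close> is
    the sum of the indicators of the \<open>B p\<close>. The indicator of \<open>U\<close> on the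
    constant term makes it vanish outside the cube and keeps it integrable.\<close>
  define h where "h \<alpha> = (\<Sum>p\<in>P. \<Sum>q\<in>P. indicator (B p \<inter> B q) \<alpha>)
      - 2 * M * (\<Sum>p\<in>P. indicator (B p) \<alpha>) + M\<^sup>2 * (indicator U \<alpha> :: real)" for \<alpha>
  have h: "M\<^sup>2 * indicator Z \<alpha> \<le> h \<alpha>" for \<alpha>
  proof (cases "\<alpha> \<in> U")
    case True
    define f where "f = (\<Sum>p\<in>P. indicator (B p) \<alpha> :: real)"
    have "h \<alpha> = (f - M)\<^sup>2"
      using True unfolding h_def f_def indicator_inter_arith
      by (simp add: power2_eq_square sum_product algebra_simps sum_distrib_left)
    moreover have "f = 0" if "\<alpha> \<in> Z" using that by (auto simp: f_def Z_def)
    ultimately show ?thesis by (auto simp: indicator_def)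
  next
    case False
    then have "\<alpha> \<notin> B p" for p using BU by auto
    then show ?thesis using False by (simp add: h_def Z_def)
  qed
  have "measure lborel Z * M\<^sup>2 = (\<integral>\<alpha>. M\<^sup>2 * indicator Z \<alpha> \<partial>lborel)" by simp
  also have "\<dots> \<le> (\<integral>\<alpha>. h \<alpha> \<partial>lborel)"
    using h intZ intB intBB intU unfolding h_def
    by (intro integral_mono Bochner_Integration.integrable_add Bochner_Integration.integrable_diff
        integrable_mult_right Bochner_Integration.integrable_sum) auto
  also have "\<dots> = (\<Sum>p\<in>P. \<Sum>q\<in>P. measure lborel (B p \<inter> B q)) - 2 * M * (\<Sum>p\<in>P. measure lborel (B p)) + M\<^sup>2 * measure lborel U"
    unfolding h_def using intB intBB intU by simp
  also have "(\<Sum>p\<in>P. measure lborel (B p)) = M"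
  proof -
    have "measure lborel (B p) = (2 * s) ^ CARD('d)" if "p \<in> P" for p
      unfolding B_def using pos[OF that] by (rule measure_near_set[OF s])
    then show ?thesis by (simp add: M_def)
  qed
  also have "measure lborel U = 1" using U1 by (simp add: measure_def)
  also have "(\<Sum>p\<in>P. \<Sum>q\<in>P. measure lborel (B p \<inter> B q)) - 2 * M * M + M\<^sup>2 * 1
      \<le> (\<Sum>p\<in>P. \<Sum>q\<in>P. \<Prod>i\<in>UNIV. 4 * s\<^sup>2 + 2 * s * gcd_ratio (c p i) (c q i)) - 2 * M * M + M\<^sup>2 * 1"
    unfolding B_def using pos s by (intro add_right_mono diff_right_mono sum_mono measure_near_set_Int_le) auto
  also have "\<dots> = (\<Sum>p\<in>P. \<Sum>q\<in>P. (\<Prod>i\<in>UNIV. 4 * s\<^sup>2 + 2 * s * gcd_ratio (c p i) (c q i)) - (4 * s\<^sup>2) ^ CARD('d))"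
  proof -
    have "((2 * s) ^ CARD('d))\<^sup>2 = (4 * s\<^sup>2) ^ CARD('d)"
      by (subst power_even_eq[symmetric], subst mult.commute, subst power_mult) (simp add: power_mult_distrib)
    then have "M\<^sup>2 = (\<Sum>p\<in>P. \<Sum>q\<in>P. (4 * s\<^sup>2) ^ CARD('d))"
      by (simp add: M_def power_mult_distrib power2_eq_square)
    then show ?thesis by (simp add: sum_subtractf power2_eq_square)
  qed
  finally show ?thesis unfolding Z_def M_def U_def B_def .
qed

section \<open>Reduction to small distances\<close>

lemma nid_infnorm_frac_vec_diff_le:
  fixes y z :: "real ^ 'd::finite"
  assumes "\<And>i. near_int s (y $ i - z $ i)"
  shows "nid_infnorm (frac_vec y - frac_vec z) \<le> s"
proof -
  \<comment> \<open>Adding this \<open>k\<close> undoes both floors and subtracts the nearest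
    integer from each \<open>y $ i - z $ i\<close>.\<close>
  define k :: "int ^ 'd" where "k = (\<chi> i. \<lfloor>y $ i\<rfloor> - \<lfloor>z $ i\<rfloor> - round (y $ i - z $ i))"
  let ?w = "frac_vec y - frac_vec z + int_vec k"
  have "\<bar>?w $ i\<bar> \<le> s" for i
    using assms[of i] by (simp add: frac_vec_def int_vec_def k_def frac_def near_int_def)
  moreover have "{\<bar>?w $ i\<bar> |i. i \<in> UNIV} \<noteq> {}" by blast
  ultimately have "infnorm ?w \<le> s"
    unfolding infnorm_cart by (intro cSup_least) auto
  moreover have "nid_infnorm (frac_vec y - frac_vec z) \<le> infnorm ?w"
    unfolding nid_infnorm_def by (intro cINF_lower bdd_belowI[of _ 0]) (auto simp: infnorm_pos_le)
  ultimately show ?thesis by linarith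
qed

lemma min_gap_le:
  assumes "n \<in> {1..N}" "m \<in> {1..N}" "n \<noteq> m"
  shows "min_gap x N \<le> nid_infnorm (x n - x m)"
  unfolding min_gap_def
proof (rule Min_le)
  have "{nid_infnorm (x n - x m) |n m. n \<in> {1..N} \<and> m \<in> {1..N} \<and> n \<noteq> m}
     \<subseteq> (\<lambda>(n, m). nid_infnorm (x n - x m)) ` ({1..N} \<times> {1..N})" by auto
  then show "finite {nid_infnorm (x n - x m) |n m. n \<in> {1..N} \<and> m \<in> {1..N} \<and> n \<noteq> m}"
    by (rule finite_subset) auto
qed (use assms in blast)

text \<open>Here \<open>b k\<close> bounds the variance divided by the squared mean, hence the
  measure of the set where no event of stage \<open>k\<close> occurs. Summability is what
  Borel-Cantelli asks for.\<close>

lemma AE_eventually_in_near_set: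
  fixes c :: "'p \<Rightarrow> 'd::finite \<Rightarrow> nat" and P :: "nat \<Rightarrow> 'p set"
  assumes fin: "\<And>k. finite (P k)" and pos: "\<And>k p i. p \<in> P k \<Longrightarrow> c p i > 0"
    and s: "\<forall>\<^sub>F k in sequentially. 0 < s k \<and> s k < 1 / 2 \<and> P k \<noteq> {}"
    and sm: "summable b"
    and bound: "\<forall>\<^sub>F k in sequentially.
      (\<Sum>p\<in>P k. \<Sum>q\<in>P k. (\<Prod>i\<in>UNIV. 4 * (s k)\<^sup>2 + 2 * s k * gcd_ratio (c p i) (c q i)) - (4 * (s k)\<^sup>2) ^ CARD('d))
        \<le> b k * (real (card (P k)) * (2 * s k) ^ CARD('d))\<^sup>2"
  shows "AE \<alpha> \<in> cbox 0 1 in lebesgue. \<forall>\<^sub>F k in sequentially. \<exists>p\<in>P k. \<alpha> \<in> near_set (s k) (c p)"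
proof -
  define A where "A k = cbox 0 1 - (\<Union>p\<in>P k. near_set (s k) (c p))" for k
  have meas: "A k \<in> sets lborel" for k
  proof -
    have "(\<Union>p\<in>P k. near_set (s k) (c p)) \<in> sets borel" using fin by (rule sets.finite_UN) measurable
    then have "cbox 0 1 - (\<Union>p\<in>P k. near_set (s k) (c p)) \<in> sets borel" by (rule sets.Diff[rotated]) simp
    then show ?thesis by (simp only: A_def sets_lborel)
  qed
  have "emeasure lborel (A k) \<le> emeasure lborel (cbox 0 (1 :: real ^ 'd))" for k
    by (intro emeasure_mono) (auto simp: A_def)
  then have em: "emeasure lborel (A k) < \<infinity>" for k
    using le_less_trans[of _ 1 "\<infinity> :: ennreal"] by (simp add: emeasure_unit_cbox)
  have "\<forall>\<^sub>F k in sequentially. norm (measure lborel (A k)) \<le> b k"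
    using s bound
  proof eventually_elim
    case (elim k)
    let ?M = "(real (card (P k)) * (2 * s k) ^ CARD('d))\<^sup>2"
    have "measure lborel (A k) * ?M \<le> b k * ?M"
      using second_moment_bound[of "s k" "P k" c] elim fin pos unfolding A_def by fastforce
    moreover have "?M > 0" using elim fin by (simp add: card_gt_0_iff)
    ultimately show ?case by simp
  qed
  then have "summable (\<lambda>k. measure lborel (A k))"
    using sm by (rule summable_comparison_test_ev)
  then have "AE \<alpha> in lborel. \<forall>\<^sub>F k in sequentially. \<alpha> \<in> space lborel - A k"
    using meas em by (intro borel_cantelli_AE1) auto
  then have "AE \<alpha> in lborel. \<alpha> \<in> cbox 0 1 \<longrightarrow> (\<forall>\<^sub>F k in sequentially. \<exists>p\<in>P k. \<alpha> \<in> near_set (s k) (c p))"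
    by eventually_elim (auto elim!: eventually_mono simp: A_def)
  then show ?thesis by (rule AE_completion)
qed

section \<open>Sums of gcd ratios over a finite set of integers\<close>

text \<open>The reduced fraction of \<open>p / q\<close> has one entry equal to \<open>w\<close> and
  the other at most \<open>w\<close>, and together with \<open>p\<close> it determines
  \<open>q\<close>.\<close>

lemma card_gcd_level_le:
  assumes "p > 0" "w > 0"
  shows "finite {q. q > 0 \<and> max p q = w * gcd p q}" "card {q. q > 0 \<and> max p q = w * gcd p q} \<le> 2 * w"
proof -
  let ?Q = "{q. q > 0 \<and> max p q = w * gcd p q}"
  let ?f = "\<lambda>q. (p div gcd p q, q div gcd p q)"
  let ?R = "{w} \<times> {1..w} \<union> {1..w} \<times> {w}"
  have inj: "inj_on ?f ?Q"
  proof (rule inj_onI)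
    fix q r assume qr: "q \<in> ?Q" "r \<in> ?Q" "?f q = ?f r"
    have "p = gcd p q * (p div gcd p q)" "p = gcd p r * (p div gcd p r)" by auto
    then have "gcd p q = gcd p r" using qr \<open>p > 0\<close>
      by (metis Pair_inject mult_cancel2 mult_0_right less_numeral_extra(3))
    moreover have "q = gcd p q * (q div gcd p q)" "r = gcd p r * (r div gcd p r)" by auto
    ultimately show "q = r" using qr by (metis Pair_inject)
  qed
  have sub: "?f ` ?Q \<subseteq> ?R"
  proof (rule image_subsetI)
    fix q assume "q \<in> ?Q"
    then have q: "q > 0" "max p q = w * gcd p q" by auto
    define g where "g = gcd p q"
    obtain u v where uv: "p = g * u" "q = g * v" unfolding g_def by (meson dvdE gcd_dvd1 gcd_dvd2)
    have "g > 0" "u > 0" "v > 0" using uv q(1) \<open>p > 0\<close> by (auto intro!: Nat.gr0I)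
    have "max p q = w * g" using q(2) by (simp add: g_def)
    then have "max (g * u) (g * v) = w * g" by (simp only: uv[symmetric])
    then have "g * max u v = w * g" by (simp only: nat_mult_max_right)
    then have "max u v = w" using \<open>g > 0\<close> by simp
    moreover have "p div gcd p q = u" "q div gcd p q = v" unfolding g_def[symmetric] using uv \<open>g > 0\<close> by auto
    ultimately show "?f q \<in> ?R"
      using \<open>u > 0\<close> \<open>v > 0\<close> by (auto simp: max_def split: if_splits)
  qed
  show "finite ?Q" using inj_on_finite[OF inj sub] by simp
  have "card ?Q \<le> card ?R" using inj sub by (rule card_inj_on_le) simp
  also have "\<dots> \<le> card ({w} \<times> {1..w}) + card ({1..w} \<times> {w})" by (rule card_Un_le)
  finally show "card ?Q \<le> 2 * w" by (simp add: card_cartesian_product)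
qed

text \<open>The elements are sorted by the inverse \<open>w\<close> of their ratio: levels up to
  \<open>V\<close> are counted by \<open>card_gcd_level_le\<close>, and beyond \<open>V\<close> each
  term is at most \<open>B\<close>. A general \<open>F\<close> covers the first and the second power
  of the ratio.\<close>

lemma sum_over_gcd_ratio_le:
  fixes F :: "real \<Rightarrow> real"
  assumes "finite T" "p > 0" "\<And>q. q \<in> T \<Longrightarrow> q > 0" "V > 0"
    and F0: "\<And>x. F x \<ge> 0" and B: "\<And>x. 0 < x \<Longrightarrow> x \<le> 1 / real V \<Longrightarrow> F x \<le> B"
  shows "(\<Sum>q\<in>T. F (gcd_ratio p q)) \<le> (\<Sum>w=1..V. 2 * real w * F (1 / real w)) + real (card T) * B"
proof -
  define W where "W q = max p q div gcd p q" for q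
  have W: "max p q = W q * gcd p q" for q by (simp add: W_def max_def)
  have Wpos: "W q > 0" if "q \<in> T" for q
    using W[of q] \<open>p > 0\<close> by (intro Nat.gr0I) (simp add: max_def split: if_splits)
  have ratio: "gcd_ratio p q = 1 / real (W q)" for q
    unfolding gcd_ratio_def W using \<open>p > 0\<close> by simp
  have "B \<ge> 0" using B[of "1 / real V"] F0[of "1 / real V"] \<open>V > 0\<close> by simp
  define T1 where "T1 = {q \<in> T. W q \<le> V}"
  have fT1: "finite T1" "W ` T1 \<subseteq> {1..V}" using assms(1) Wpos by (auto simp: T1_def Suc_le_eq)
  have "(\<Sum>q\<in>T1. F (1 / real (W q))) = (\<Sum>w=1..V. \<Sum>q | q \<in> T1 \<and> W q = w. F (1 / real (W q)))"
    using fT1 by (intro sum.group[symmetric]) auto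
  also have "\<dots> \<le> (\<Sum>w=1..V. 2 * real w * F (1 / real w))"
  proof (rule sum_mono)
    fix w assume w: "w \<in> {1..V}"
    have "card {q \<in> T1. W q = w} \<le> card {q. q > 0 \<and> max p q = w * gcd p q}"
      using card_gcd_level_le[OF \<open>p > 0\<close>, of w] w assms(3) W by (intro card_mono) (auto simp: T1_def)
    also have "\<dots> \<le> 2 * w" using card_gcd_level_le[OF \<open>p > 0\<close>, of w] w by simp
    finally have "real (card {q \<in> T1. W q = w}) \<le> 2 * real w" by linarith
    then show "(\<Sum>q | q \<in> T1 \<and> W q = w. F (1 / real (W q))) \<le> 2 * real w * F (1 / real w)"
      using F0 by (simp add: mult_right_mono)
  qed
  finally have 1: "(\<Sum>q\<in>T1. F (1 / real (W q))) \<le> (\<Sum>w=1..V. 2 * real w * F (1 / real w))" .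
  have "(\<Sum>q\<in>T - T1. F (1 / real (W q))) \<le> (\<Sum>q\<in>T - T1. B)"
    using \<open>V > 0\<close> Wpos by (intro sum_mono B) (auto simp: T1_def field_simps)
  also have "\<dots> \<le> real (card T) * B"
    using assms(1) \<open>B \<ge> 0\<close> by (auto intro!: mult_right_mono card_mono)
  finally have 2: "(\<Sum>q\<in>T - T1. F (1 / real (W q))) \<le> real (card T) * B" .
  have "(\<Sum>q\<in>T. F (1 / real (W q))) = (\<Sum>q\<in>T - T1. F (1 / real (W q))) + (\<Sum>q\<in>T1. F (1 / real (W q)))"
    using assms(1) by (intro sum.subset_diff) (auto simp: T1_def)
  with 1 2 show ?thesis by (simp add: ratio)
qed

text \<open>The level \<open>V\<close>, at least the square root of \<open>card T\<close>, balances
  both parts of the first sum: \<open>2 * V\<close> from the levels and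
  \<open>card T / V \<le> V\<close> from the rest. For squares level \<open>w\<close> contributes
  \<open>2 / w\<close>, hence the harmonic number.\<close>

lemma sum_gcd_ratio_le:
  assumes "finite T" "p > 0" "\<And>q. q \<in> T \<Longrightarrow> q > 0" "V > 0" "card T \<le> V\<^sup>2"
  shows "(\<Sum>q\<in>T. gcd_ratio p q) \<le> 3 * real V"
    and "(\<Sum>q\<in>T. (gcd_ratio p q)\<^sup>2) \<le> 2 * harm V + 1"
proof -
  have card: "real (card T) \<le> (real V)\<^sup>2" using assms(5) by (metis of_nat_le_iff of_nat_power)
  \<comment> \<open>The absolute value makes \<open>F\<close> nonnegative on all reals, as the
    general bound requires; the ratios are nonnegative anyway.\<close>
  have "(\<Sum>q\<in>T. \<bar>gcd_ratio p q\<bar>) \<le> (\<Sum>w=1..V. 2 * real w * \<bar>1 / real w\<bar>) + real (card T) * (1 / real V)"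
    using assms by (intro sum_over_gcd_ratio_le) auto
  also have "(\<Sum>w=1..V. 2 * real w * \<bar>1 / real w\<bar>) = (\<Sum>w=1..V. 2)" by (intro sum.cong) auto
  also have "real (card T) * (1 / real V) \<le> real V"
    using card assms(4) by (simp add: field_simps power2_eq_square)
  finally show "(\<Sum>q\<in>T. gcd_ratio p q) \<le> 3 * real V" by (simp add: gcd_ratio_nonneg)
  have "(\<Sum>q\<in>T. (gcd_ratio p q)\<^sup>2) \<le> (\<Sum>w=1..V. 2 * real w * (1 / real w)\<^sup>2) + real (card T) * (1 / real V)\<^sup>2"
    using assms by (intro sum_over_gcd_ratio_le power_mono) auto
  also have "(\<Sum>w=1..V. 2 * real w * (1 / real w)\<^sup>2) = 2 * harm V"
    unfolding harm_def sum_distrib_left by (intro sum.cong refl) (simp add: power2_eq_square field_simps)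
  also have "real (card T) * (1 / real V)\<^sup>2 \<le> 1"
    using card assms(4) by (simp add: field_simps power_divide)
  finally show "(\<Sum>q\<in>T. (gcd_ratio p q)\<^sup>2) \<le> 2 * harm V + 1" by simp
qed

text \<open>Of the mixed terms in the binomial expansion only the two extreme ones are kept: the sum
  of the first power of \<open>x\<close> and that of its \<open>d\<close>-th power are estimated
  separately.\<close>

lemma power_add_diff_le:
  fixes A x :: real
  assumes "0 \<le> A" "0 \<le> x" "d > 0"
  shows "(A + x) ^ d - A ^ d \<le> real d * 2 ^ (d - 1) * (x * A ^ (d - 1) + x ^ d)"
proof -
  have "(A + x) ^ d - A ^ d = x * (\<Sum>i<d. (A + x) ^ i * A ^ (d - Suc i))"
    using power_diff_sumr2[of "A + x" d A] by (simp add: mult.commute)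
  also have "\<dots> \<le> x * (\<Sum>i<d. (A + x) ^ (d - 1))"
  proof (intro mult_left_mono sum_mono)
    fix i assume i: "i \<in> {..<d}"
    have "(A + x) ^ i * A ^ (d - Suc i) \<le> (A + x) ^ i * (A + x) ^ (d - Suc i)"
      using assms by (intro mult_left_mono power_mono) auto
    also have "\<dots> = (A + x) ^ (d - 1)" using i by (simp flip: power_add)
    finally show "(A + x) ^ i * A ^ (d - Suc i) \<le> (A + x) ^ (d - 1)" .
  qed (use assms in auto)
  also have "\<dots> = x * real d * (A + x) ^ (d - 1)" by simp
  also have "\<dots> \<le> x * real d * (2 ^ (d - 1) * (A ^ (d - 1) + x ^ (d - 1)))"
  proof (intro mult_left_mono)
    have "(A + x) ^ (d - 1) \<le> (2 * max A x) ^ (d - 1)" using assms by (intro power_mono) auto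
    also have "\<dots> \<le> 2 ^ (d - 1) * (A ^ (d - 1) + x ^ (d - 1))"
      using assms by (auto simp: power_mult_distrib max_def)
    finally show "(A + x) ^ (d - 1) \<le> 2 ^ (d - 1) * (A ^ (d - 1) + x ^ (d - 1))" .
  qed (use assms in auto)
  also have "\<dots> = real d * 2 ^ (d - 1) * (x * A ^ (d - 1) + x * x ^ (d - 1))" by (simp add: algebra_simps)
  also have "x * x ^ (d - 1) = x ^ d" using assms(3) by (simp flip: power_Suc)
  finally show ?thesis .
qed

section \<open>Multiples of a single sequence\<close>

lemma finite_pos_diffs: "finite A \<Longrightarrow> finite (pos_diffs A)"
  by (rule finite_subset[of _ "(\<lambda>(x, y). x - y) ` (A \<times> A)"]) (auto simp: pos_diffs_def)

lemma pos_diffs_mono: "A \<subseteq> B \<Longrightarrow> pos_diffs A \<subseteq> pos_diffs B"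
  by (auto simp: pos_diffs_def)

lemma card_pos_diffs_le: "finite A \<Longrightarrow> card (pos_diffs A) \<le> card A ^ 2"
  using surj_card_le[of "A \<times> A" "pos_diffs A" "\<lambda>(x, y). x - y"]
  by (auto simp: pos_diffs_def card_cartesian_product power2_eq_square)

text \<open>The distances to the minimum are distinct. This makes the difference sets of an
  injective sequence grow without bound, so that every scale \<open>4^k\<close> is reached.\<close>

lemma card_pos_diffs_ge:
  assumes "finite A"
  shows "card A \<le> card (pos_diffs A) + 1"
proof (cases "A = {}")
  case False
  have "inj_on (\<lambda>x. x - Min A) (A - {Min A})" by (auto simp: inj_on_def)
  moreover have "(\<lambda>x. x - Min A) ` (A - {Min A}) \<subseteq> pos_diffs A"
  proof (rule image_subsetI)
    fix x assume "x \<in> A - {Min A}"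
    moreover from this have "Min A < x" using Min_le[OF assms, of x] by auto
    ultimately show "x - Min A \<in> pos_diffs A"
      unfolding pos_diffs_def using Min_in[OF assms False] by auto
  qed
  ultimately have "card (A - {Min A}) \<le> card (pos_diffs A)"
    using finite_pos_diffs[OF assms] by (rule card_inj_on_le)
  then show ?thesis using assms False by simp
qed simp

lemma sum_overlap_diff_le:
  fixes s :: real
  assumes "finite T" "\<And>q. q \<in> T \<Longrightarrow> q > 0" "card T = (2 ^ k)\<^sup>2" "s > 0" "d \<ge> 2"
  shows "(\<Sum>p\<in>T. \<Sum>q\<in>T. (4 * s\<^sup>2 + 2 * s * gcd_ratio p q) ^ d - (4 * s\<^sup>2) ^ d)
     \<le> real d * 2 ^ (d - 1) * (3 / (s * 2 ^ k) + (2 * real k + 3) / (s ^ d * (2 ^ k)\<^sup>2)) * (real (card T) * (2 * s) ^ d)\<^sup>2"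
proof -
  define \<kappa> where "\<kappa> = real d * 2 ^ (d - 1)"
  define V :: nat where "V = 2 ^ k"
  have "V > 0" by (simp add: V_def)
  have "harm V \<le> 1 + real k * ln 2" using harm_le_ln[of V] by (simp add: V_def ln_realpow)
  also have "\<dots> \<le> 1 + real k" using ln_2_less_1 by (simp add: mult_left_le)
  finally have harm: "2 * harm V + 1 \<le> 2 * real k + 3" by simp
  have r2: "(\<Sum>q\<in>T. (gcd_ratio p q)\<^sup>2) \<le> 2 * real k + 3" and r1: "(\<Sum>q\<in>T. gcd_ratio p q) \<le> 3 * real V" if "p \<in> T" for p
    using sum_gcd_ratio_le[of T p V] assms that harm by (auto simp: V_def)
  have d1: "(s\<^sup>2) ^ (d - 1) * s * s = (s ^ d)\<^sup>2"
  proof -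
    have "(s\<^sup>2) ^ (d - 1) * s\<^sup>2 = (s\<^sup>2) ^ d" using assms(5) by (intro power_minus_mult) simp
    then show ?thesis by (simp add: power2_eq_square power_mult_distrib)
  qed
  have "(\<Sum>p\<in>T. \<Sum>q\<in>T. (4 * s\<^sup>2 + 2 * s * gcd_ratio p q) ^ d - (4 * s\<^sup>2) ^ d)
    \<le> (\<Sum>p\<in>T. \<Sum>q\<in>T. \<kappa> * (2 * s * (4 * s\<^sup>2) ^ (d - 1) * gcd_ratio p q + (2 * s) ^ d * (gcd_ratio p q)\<^sup>2))"
  proof (intro sum_mono)
    fix p q assume pq: "p \<in> T" "q \<in> T"
    have "(4 * s\<^sup>2 + 2 * s * gcd_ratio p q) ^ d - (4 * s\<^sup>2) ^ d
      \<le> \<kappa> * (2 * s * gcd_ratio p q * (4 * s\<^sup>2) ^ (d - 1) + (2 * s * gcd_ratio p q) ^ d)"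
      unfolding \<kappa>_def using assms by (intro power_add_diff_le) (auto simp: gcd_ratio_nonneg)
    \<comment> \<open>Here \<open>d \<ge> 2\<close> enters: the bound for the sum of squares is only
      logarithmic, whereas that for the sum of first powers is of order \<open>V\<close>.\<close>
    also have "gcd_ratio p q ^ d \<le> (gcd_ratio p q)\<^sup>2"
      using pq assms(2,5) by (intro power_decreasing) (auto simp: gcd_ratio_nonneg gcd_ratio_le_1)
    then have "(2 * s * gcd_ratio p q) ^ d \<le> (2 * s) ^ d * (gcd_ratio p q)\<^sup>2"
      unfolding power_mult_distrib[of "2 * s"] using assms(4) by (intro mult_left_mono) auto
    then have "\<kappa> * (2 * s * gcd_ratio p q * (4 * s\<^sup>2) ^ (d - 1) + (2 * s * gcd_ratio p q) ^ d)
      \<le> \<kappa> * (2 * s * (4 * s\<^sup>2) ^ (d - 1) * gcd_ratio p q + (2 * s) ^ d * (gcd_ratio p q)\<^sup>2)"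
      by (intro mult_left_mono add_mono) (auto simp: \<kappa>_def)
    finally show "(4 * s\<^sup>2 + 2 * s * gcd_ratio p q) ^ d - (4 * s\<^sup>2) ^ d
      \<le> \<kappa> * (2 * s * (4 * s\<^sup>2) ^ (d - 1) * gcd_ratio p q + (2 * s) ^ d * (gcd_ratio p q)\<^sup>2)" .
  qed
  also have "\<dots> = (\<Sum>p\<in>T. \<kappa> * (2 * s * (4 * s\<^sup>2) ^ (d - 1) * (\<Sum>q\<in>T. gcd_ratio p q) + (2 * s) ^ d * (\<Sum>q\<in>T. (gcd_ratio p q)\<^sup>2)))"
    by (simp only: sum_distrib_left[symmetric] sum.distrib)
  also have "\<dots> \<le> (\<Sum>p\<in>T. \<kappa> * (2 * s * (4 * s\<^sup>2) ^ (d - 1) * (3 * real V) + (2 * s) ^ d * (2 * real k + 3)))"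
    using assms(4) by (intro sum_mono mult_left_mono add_mono r1 r2) (auto simp: \<kappa>_def)
  also have "\<dots> = \<kappa> * (real V)\<^sup>2 * (2 * s * (4 * s\<^sup>2) ^ (d - 1) * (3 * real V) + (2 * s) ^ d * (2 * real k + 3))"
    using assms(3) by (simp add: V_def)
  also have "\<dots> \<le> \<kappa> * (real V)\<^sup>2 * (4 ^ d * (s ^ d)\<^sup>2 / s * (3 * real V) + 4 ^ d * s ^ d * (2 * real k + 3))"
  proof (intro mult_left_mono add_mono mult_right_mono)
    have "2 * s * (4 * s\<^sup>2) ^ (d - 1) = 2 * 4 ^ (d - 1) * ((s\<^sup>2) ^ (d - 1) * s * s) / s"
    proof -
      have "2 * s * (c * X) = 2 * c * (X * s * s) / s" for c X using assms(4) by simp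
      then show ?thesis unfolding power_mult_distrib .
    qed
    also have "\<dots> \<le> 4 ^ d * (s ^ d)\<^sup>2 / s"
    proof -
      have "(4 :: real) ^ (d - 1) * 4 = 4 ^ d" using assms(5) by (intro power_minus_mult) simp
      then have "2 * 4 ^ (d - 1) \<le> (4 :: real) ^ d" using zero_le_power[of "4 :: real" "d - 1"] by linarith
      then show ?thesis unfolding d1 using assms(4) by (intro divide_right_mono mult_right_mono) auto
    qed
    finally show "2 * s * (4 * s\<^sup>2) ^ (d - 1) \<le> 4 ^ d * (s ^ d)\<^sup>2 / s" .
    show "(2 * s) ^ d \<le> 4 ^ d * s ^ d" unfolding power_mult_distrib using assms(4)
      by (intro mult_right_mono power_mono) auto
  qed (auto simp: \<kappa>_def)
  also have "\<dots> = \<kappa> * (3 / (s * V) + (2 * real k + 3) / (s ^ d * (real V)\<^sup>2)) * ((real V)\<^sup>2 * (real V)\<^sup>2 * 4 ^ d * (s ^ d)\<^sup>2)"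
    using assms(4) \<open>V > 0\<close> by (simp add: field_simps power2_eq_square)
  also have "(real V)\<^sup>2 * (real V)\<^sup>2 * 4 ^ d * (s ^ d)\<^sup>2 = (real (card T) * (2 * s) ^ d)\<^sup>2"
  proof -
    have "(4 :: real) ^ d = (2 ^ d)\<^sup>2" using power_mult_distrib[of "2 :: real" 2 d] by (simp add: power2_eq_square)
    then show ?thesis using assms(3) by (simp add: V_def power_mult_distrib power2_eq_square)
  qed
  finally show ?thesis by (simp add: \<kappa>_def V_def)
qed

lemma min_gap_scalar_ae:
  fixes a :: "nat \<Rightarrow> int"
  assumes d2: "CARD('d::finite) \<ge> 2" and "\<delta> > 0" and inj: "inj_on a {1..}"
  shows "AE \<alpha> \<in> cbox 0 1 in (lebesgue :: (real ^ 'd) measure).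
          \<forall>\<^sub>F N in sequentially.
            min_gap (\<lambda>n. frac_vec (real_of_int (a n) *\<^sub>R \<alpha>)) N
              \<le> ln (real N) powr (1 + 1 / real CARD('d) + \<delta>)
                  / real (num_pos_diffs a N) powr (1 / real CARD('d))"
proof -
  define d where "d = CARD('d)"
  have d: "d \<ge> 2" "real d > 0" using d2 by (auto simp: d_def)
  define e where "e = 1 + 1 / real d + \<delta>"
  have "e * real d = real d + 1 + \<delta> * real d" using d by (simp add: e_def field_simps)
  moreover have "\<delta> * real d > 0" using d \<open>\<delta> > 0\<close> by simp
  moreover have "real d \<ge> 2" using d by simp
  ultimately have e: "e > 1" "e * real d \<ge> 3"
    using \<open>\<delta> > 0\<close> by (simp add: e_def add_pos_pos, linarith)
  define D where "D N = pos_diffs (a ` {1..N})" for N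
  have finD: "finite (D N)" for N by (simp add: D_def finite_pos_diffs)
  have D_mono: "D N \<subseteq> D N'" if "N \<le> N'" for N N'
    unfolding D_def using that by (intro pos_diffs_mono) auto
  have card_a: "card (a ` {1..N}) = N" for N
    using card_image[OF inj_on_subset[OF inj, of "{1..N}"]] by auto
  have D_le: "card (D N) \<le> N\<^sup>2" and D_ge: "N \<le> card (D N) + 1" for N
    using card_pos_diffs_le[of "a ` {1..N}"] card_pos_diffs_ge[of "a ` {1..N}"] by (simp_all only: card_a D_def finite_imageI finite_atLeastAtMost)
  \<comment> \<open>The scale is the size of the difference set, not \<open>N\<close>: between two powers of \<open>2\<close> the number
    \<open>C_N\<close> may grow by more than a constant factor.\<close>
  define K where "K k = (LEAST N. (2 ^ k)\<^sup>2 \<le> card (D N))" for k :: nat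
  have K: "(2 ^ k)\<^sup>2 \<le> card (D (K k))" for k
  proof -
    have "(2 ^ k)\<^sup>2 \<le> card (D ((2 ^ k)\<^sup>2 + 1))" using D_ge[of "(2 ^ k)\<^sup>2 + 1"] by simp
    then show ?thesis unfolding K_def by (rule LeastI)
  qed
  have "\<exists>P. P \<subseteq> nat ` D (K k) \<and> card P = (2 ^ k)\<^sup>2" for k
  proof -
    have "inj_on nat (D (K k))" by (auto simp: inj_on_def D_def pos_diffs_def)
    then have "(2 ^ k)\<^sup>2 \<le> card (nat ` D (K k))" using K[of k] by (simp add: card_image)
    then show ?thesis by (meson obtain_subset_with_card_n)
  qed
  then obtain P where P: "\<And>k. P k \<subseteq> nat ` D (K k)" "\<And>k. card (P k) = (2 ^ k)\<^sup>2" by metis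
  have finP: "finite (P k)" for k using P(1)[of k] finD by (meson finite_imageI finite_subset)
  have posP: "p > 0" if "p \<in> P k" for p k using P(1)[of k] that by (auto simp: D_def pos_diffs_def)
  \<comment> \<open>Chosen so that \<open>s k\<close> is below the claimed bound whenever
    \<open>4^k \<le> C_N < 4^(k+1)\<close>: the upper end bounds the denominator, and
    \<open>4^k \<le> C_N \<le> N^2\<close> gives \<open>k * ln 2 \<le> ln N\<close>.\<close>
  define s where "s k = (real k * ln 2) powr e / 4 powr ((real k + 1) / real d)" for k :: nat
  \<comment> \<open>The constant 6 is \<open>3 * 2\<close>, from
    \<open>4^((k+1)/d) \<le> 2 * 2^k\<close> for \<open>d \<ge> 2\<close>. The constant 20 is
    \<open>5 * 4\<close>, from \<open>2 * k + 3 \<le> 5 * k\<close> and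
    \<open>4^(k+1) = 4 * 4^k\<close>.\<close>
  define b where "b k = real d * 2 ^ (d - 1) * (6 * (real k * ln 2) powr (- e) + 20 * real k * (real k * ln 2) powr (- (e * real d)))"
    for k :: nat
  have b: "summable b"
  proof -
    have b_eq: "b = (\<lambda>k. real d * 2 ^ (d - 1) * (6 * ln 2 powr (- e)) * real k powr (- e)
        + real d * 2 ^ (d - 1) * (20 * ln 2 powr (- (e * real d))) * real k powr (1 - e * real d))"
    proof
      fix k :: nat
      have "real k * real k powr (- (e * real d)) = real k powr (1 - e * real d)"
        by (cases "k = 0") (auto simp: powr_diff powr_minus field_simps)
      then show "b k = real d * 2 ^ (d - 1) * (6 * ln 2 powr (- e)) * real k powr (- e)
        + real d * 2 ^ (d - 1) * (20 * ln 2 powr (- (e * real d))) * real k powr (1 - e * real d)"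
        unfolding b_def by (simp add: powr_mult algebra_simps)
    qed
    have "- e < - 1" "1 - e * real d < - 1" using e by linarith+
    then have "summable (\<lambda>k. real k powr (- e))" "summable (\<lambda>k. real k powr (1 - e * real d))"
      by (simp_all only: summable_real_powr_iff)
    then show ?thesis unfolding b_eq by (intro summable_add summable_mult)
  qed
  have "s \<longlonglongrightarrow> 0" unfolding s_def using d(2) e(1) by real_asymp
  then have "\<forall>\<^sub>F k in sequentially. s k < 1 / 2" by (rule order_tendstoD) simp
  then have ev_s: "\<forall>\<^sub>F k in sequentially. 0 < s k \<and> s k < 1 / 2 \<and> P k \<noteq> {}"
    using eventually_gt_at_top[of 0]
  proof eventually_elim
    case (elim k)
    have "P k \<noteq> {}" using P(2)[of k] by auto
    then show ?case using elim by (simp add: s_def)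
  qed
  have bound: "(\<Sum>p\<in>P k. \<Sum>q\<in>P k. (\<Prod>i\<in>(UNIV :: 'd set). 4 * (s k)\<^sup>2 + 2 * s k * gcd_ratio p q) - (4 * (s k)\<^sup>2) ^ CARD('d))
        \<le> b k * (real (card (P k)) * (2 * s k) ^ CARD('d))\<^sup>2" if "k > 0" for k
  proof -
    define L where "L = real k * ln 2"
    have "L > 0" using that by (simp add: L_def)
    have sk: "s k > 0" using that by (simp add: s_def)
    have 1: "3 / (s k * 2 ^ k) \<le> 6 * L powr (- e)"
    proof -
      have "(4 :: real) powr ((real k + 1) / real d) \<le> 4 powr ((real k + 1) / 2)"
        using d by (intro powr_mono divide_left_mono) auto
      also have "\<dots> = (2 powr 2) powr ((real k + 1) / 2)" by simp
      also have "\<dots> = 2 powr (real k + 1)" by (simp add: powr_powr del: powr_numeral)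
      also have "\<dots> = 2 * 2 ^ k" by (simp add: powr_add powr_realpow)
      finally have "L powr e / (2 * 2 ^ k) \<le> s k" unfolding s_def L_def by (intro divide_left_mono) auto
      then have half: "L powr e / 2 \<le> s k * 2 ^ k" by (simp add: field_simps)
      have "3 / (s k * 2 ^ k) \<le> 3 / (L powr e / 2)"
      proof (rule divide_left_mono[OF half])
        have "0 < L powr e / 2" using \<open>L > 0\<close> by simp
        then show "0 < s k * 2 ^ k * (L powr e / 2)" using sk by (intro mult_pos_pos zero_less_power) auto
      qed simp
      also have "\<dots> = 6 * L powr (- e)" by (simp add: powr_minus_divide)
      finally show ?thesis .
    qed
    have 2: "(2 * real k + 3) / (s k ^ d * (2 ^ k)\<^sup>2) \<le> 20 * real k * L powr (- (e * real d))"
    proof -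
      have "(4 powr ((real k + 1) / real d)) ^ d = 4 powr (real k + 1)" using d by (simp add: powr_power)
      also have "\<dots> = 4 * 4 ^ k" by (simp add: powr_add powr_realpow)
      finally have 4: "(4 powr ((real k + 1) / real d)) ^ d = 4 * (4 :: real) ^ k" .
      have "(L powr e) ^ d = L powr (e * real d)" using \<open>L > 0\<close> by (simp add: powr_power mult.commute)
      then have "s k ^ d = L powr (e * real d) / (4 * 4 ^ k)"
        unfolding s_def L_def[symmetric] power_divide 4 by simp
      moreover have "((2 :: real) ^ k)\<^sup>2 = 4 ^ k" by (simp add: power2_eq_square flip: power_mult_distrib)
      ultimately have "s k ^ d * (2 ^ k)\<^sup>2 = L powr (e * real d) / 4" by simp
      moreover have "2 * real k + 3 \<le> 5 * real k" using that by simp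
      ultimately have "(2 * real k + 3) / (s k ^ d * (2 ^ k)\<^sup>2) \<le> 5 * real k / (L powr (e * real d) / 4)"
        by (simp only:) (intro divide_right_mono, auto)
      also have "\<dots> = 20 * real k * L powr (- (e * real d))" by (simp add: powr_minus_divide)
      finally show ?thesis .
    qed
    have "(\<Sum>p\<in>P k. \<Sum>q\<in>P k. (4 * (s k)\<^sup>2 + 2 * s k * gcd_ratio p q) ^ d - (4 * (s k)\<^sup>2) ^ d)
      \<le> real d * 2 ^ (d - 1) * (3 / (s k * 2 ^ k) + (2 * real k + 3) / (s k ^ d * (2 ^ k)\<^sup>2)) * (real (card (P k)) * (2 * s k) ^ d)\<^sup>2"
      using finP posP P(2) sk d by (intro sum_overlap_diff_le) auto
    also have "\<dots> \<le> b k * (real (card (P k)) * (2 * s k) ^ d)\<^sup>2"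
      unfolding b_def L_def[symmetric] using d by (intro mult_right_mono mult_left_mono add_mono 1 2) auto
    finally show ?thesis by (simp add: d_def)
  qed
  have "AE \<alpha> \<in> cbox 0 1 in lebesgue. \<forall>\<^sub>F k in sequentially. \<exists>p\<in>P k. \<alpha> \<in> near_set (s k) (\<lambda>_ :: 'd. p)"
    using finP posP ev_s b eventually_mono[OF eventually_gt_at_top[of 0] bound]
    by (intro AE_eventually_in_near_set) auto
  then show ?thesis
  proof eventually_elim
    case (elim \<alpha>)
    show ?case
    proof
      assume "\<alpha> \<in> cbox 0 1"
      then obtain k0 where k0: "\<And>k. k \<ge> k0 \<Longrightarrow> \<exists>p\<in>P k. \<alpha> \<in> near_set (s k) (\<lambda>_ :: 'd. p)"
        using elim by (auto simp: eventually_sequentially)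
      show "\<forall>\<^sub>F N in sequentially. min_gap (\<lambda>n. frac_vec (real_of_int (a n) *\<^sub>R \<alpha>)) N
              \<le> ln (real N) powr (1 + 1 / real CARD('d) + \<delta>) / real (num_pos_diffs a N) powr (1 / real CARD('d))"
        using eventually_ge_at_top[of "4 ^ k0 + 1"]
      proof eventually_elim
        case (elim N)
        define C where "C = card (D N)"
        \<comment> \<open>\<open>C_N\<close> is at least \<open>N - 1\<close>, which accounts for
          the \<open>+ 1\<close> in the lower bound on \<open>N\<close>.\<close>
        have C4: "4 ^ k0 \<le> C" using elim D_ge[of N] by (simp add: C_def)
        then have "1 \<le> C" using order_trans[OF one_le_power[of "4 :: nat" k0]] by simp
        then obtain k where k: "4 ^ k \<le> C" "C < 4 ^ (k + 1)"
          using ex_power_ivl1[of 4 C] by auto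
        have "(4 :: nat) ^ k0 < 4 ^ (k + 1)" using C4 k by linarith
        then have "k0 < k + 1" by (rule power_less_imp_less_exp[rotated]) simp
        then obtain p where p: "p \<in> P k" "\<alpha> \<in> near_set (s k) (\<lambda>_ :: 'd. p)" using k0[of k] by auto
        have four: "(4 :: nat) ^ k = (2 ^ k)\<^sup>2" by (simp add: power2_eq_square flip: power_mult_distrib)
        \<comment> \<open>By minimality of \<open>K k\<close> the differences chosen at stage
          \<open>k\<close> already occur among the first \<open>N\<close> terms.\<close>
        have "K k \<le> N" unfolding K_def using k(1) by (intro Least_le) (simp add: four C_def)
        then have "p \<in> nat ` D N" using p(1) P(1) D_mono by blast
        then obtain n m where nm: "n \<in> {1..N}" "m \<in> {1..N}" "a n - a m > 0" "p = nat (a n - a m)"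
          by (auto simp: D_def pos_diffs_def)
        have "near_int s' ((real_of_int (a n) *\<^sub>R \<alpha>) $ i - (real_of_int (a m) *\<^sub>R \<alpha>) $ i)" if "s' = s k" for i s'
          using p(2) nm(3,4) that by (simp add: near_set_def algebra_simps)
        then have "nid_infnorm (frac_vec (real_of_int (a n) *\<^sub>R \<alpha>) - frac_vec (real_of_int (a m) *\<^sub>R \<alpha>)) \<le> s k"
          by (intro nid_infnorm_frac_vec_diff_le) auto
        moreover have "n \<noteq> m" using nm(3) by auto
        ultimately have "min_gap (\<lambda>n. frac_vec (real_of_int (a n) *\<^sub>R \<alpha>)) N \<le> s k"
          using min_gap_le[OF nm(1,2), of "\<lambda>n. frac_vec (real_of_int (a n) *\<^sub>R \<alpha>)"] by linarith
        also have "s k \<le> ln (real N) powr e / real C powr (1 / real d)"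
          unfolding s_def
        proof (rule frac_le)
          have "(2 ^ k)\<^sup>2 \<le> N\<^sup>2" using k(1) D_le[of N] unfolding four C_def by linarith
          then have "2 ^ k \<le> N" by (rule power2_le_imp_le) simp
          then have "ln (2 ^ k) \<le> ln (real N)"
            by (subst ln_le_cancel_iff) (auto simp: Suc_le_eq intro: less_le_trans[OF _ \<open>2 ^ k \<le> N\<close>])
          then have "real k * ln 2 \<le> ln (real N)" by (simp add: ln_realpow)
          then show "(real k * ln 2) powr e \<le> ln (real N) powr e" using e by (intro powr_mono2) auto
          have "real C \<le> 4 ^ (k + 1)" using k(2) by (metis less_imp_le of_nat_le_iff of_nat_numeral of_nat_power)
          also have "\<dots> = 4 powr (real k + 1)" by (simp add: powr_add powr_realpow)
          finally have "real C powr (1 / real d) \<le> (4 powr (real k + 1)) powr (1 / real d)"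
            using d by (intro powr_mono2) auto
          then show "real C powr (1 / real d) \<le> 4 powr ((real k + 1) / real d)" by (simp add: powr_powr)
        qed (use \<open>1 \<le> C\<close> in auto)
        finally show ?case by (simp add: e_def d_def C_def D_def num_pos_diffs_def)
      qed
    qed
  qed
qed

section \<open>Several sequences\<close>

definition index_pairs :: "nat \<Rightarrow> (nat \<times> nat) set" where
  "index_pairs N = {(n, m). n \<in> {1..N} \<and> m \<in> {1..N} \<and> m < n}"

lemma finite_index_pairs: "finite (index_pairs N)"
  by (rule finite_subset[of _ "{1..N} \<times> {1..N}"]) (auto simp: index_pairs_def)

lemma card_index_pairs_le: "card (index_pairs N) \<le> N\<^sup>2"
proof -
  have "index_pairs N \<subseteq> {1..N} \<times> {1..N}" by (auto simp: index_pairs_def)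
  then have "card (index_pairs N) \<le> card ({1..N} \<times> {1..N})" by (intro card_mono) auto
  then show ?thesis by (simp add: card_cartesian_product power2_eq_square)
qed

lemma card_index_pairs_ge: "N\<^sup>2 \<le> card (index_pairs (2 * N))"
proof -
  have "{N + 1..2 * N} \<times> {1..N} \<subseteq> index_pairs (2 * N)" by (auto simp: index_pairs_def)
  from card_mono[OF finite_index_pairs this] show ?thesis
    by (simp add: card_cartesian_product power2_eq_square)
qed

text \<open>Equal differences rearrange to equal sums after exchanging the two subtracted indices.
  Monotonicity and \<open>m < n\<close> ensure that the subtraction of naturals is not
  truncated.\<close>

lemma card_equal_differences_le_joint_energy:
  fixes a :: "'d \<Rightarrow> nat \<Rightarrow> nat"
  assumes mono: "\<And>i. strict_mono_on {1..} (a i)"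
  shows "card {(p, q). p \<in> index_pairs N \<and> q \<in> index_pairs N \<and>
      (\<forall>i\<in>D'. a i (fst p) - a i (snd p) = a i (fst q) - a i (snd q))} \<le> joint_energy a D' N"
  unfolding joint_energy_def
proof (rule card_inj_on_le)
  let ?f = "\<lambda>(p, q). (fst p, snd q, fst q, snd p) :: nat \<times> nat \<times> nat \<times> nat"
  have less: "a i m < a i n" if "(n, m) \<in> index_pairs N" for n m i
    using that strict_mono_onD[OF mono[of i], of m n] by (auto simp: index_pairs_def)
  show "inj_on ?f {(p, q). p \<in> index_pairs N \<and> q \<in> index_pairs N \<and>
      (\<forall>i\<in>D'. a i (fst p) - a i (snd p) = a i (fst q) - a i (snd q))}"
    by (auto simp: inj_on_def)
  show "?f ` {(p, q). p \<in> index_pairs N \<and> q \<in> index_pairs N \<and>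
      (\<forall>i\<in>D'. a i (fst p) - a i (snd p) = a i (fst q) - a i (snd q))}
    \<subseteq> {(n1, n2, n3, n4). n1 \<in> {1..N} \<and> n2 \<in> {1..N} \<and> n3 \<in> {1..N} \<and> n4 \<in> {1..N} \<and>
             (\<forall>i\<in>D'. a i n1 + a i n2 = a i n3 + a i n4)}"
  proof (rule image_subsetI)
    fix w assume "w \<in> {(p, q). p \<in> index_pairs N \<and> q \<in> index_pairs N \<and>
      (\<forall>i\<in>D'. a i (fst p) - a i (snd p) = a i (fst q) - a i (snd q))}"
    then obtain n m n' m' where w: "w = ((n, m), (n', m'))" and p: "(n, m) \<in> index_pairs N" "(n', m') \<in> index_pairs N"
      and eq: "\<forall>i\<in>D'. a i n - a i m = a i n' - a i m'" by auto
    have "a i n + a i m' = a i n' + a i m" if "i \<in> D'" for i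
      using bspec[OF eq that] less[OF p(1), of i] less[OF p(2), of i] by simp
    then show "?f w \<in> {(n1, n2, n3, n4). n1 \<in> {1..N} \<and> n2 \<in> {1..N} \<and> n3 \<in> {1..N} \<and> n4 \<in> {1..N} \<and>
             (\<forall>i\<in>D'. a i n1 + a i n2 = a i n3 + a i n4)}"
      using p by (simp add: w index_pairs_def)
  qed
  show "finite {(n1, n2, n3, n4). n1 \<in> {1..N} \<and> n2 \<in> {1..N} \<and> n3 \<in> {1..N} \<and> n4 \<in> {1..N} \<and>
             (\<forall>i\<in>D'. a i n1 + a i n2 = a i n3 + a i n4)}"
    by (rule finite_subset[of _ "{1..N} \<times> {1..N} \<times> {1..N} \<times> {1..N}"]) auto
qed

text \<open>Injectivity in a single coordinate of \<open>D'\<close> makes the fourth index a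
  function of the other three.\<close>

lemma joint_energy_le_cube:
  assumes "i \<in> D'" "strict_mono_on {1..} (a i)"
  shows "joint_energy a D' N \<le> N ^ 3"
proof -
  let ?E = "{(n1, n2, n3, n4). n1 \<in> {1..N} \<and> n2 \<in> {1..N} \<and> n3 \<in> {1..N} \<and> n4 \<in> {1..N} \<and>
             (\<forall>i\<in>D'. a i n1 + a i n2 = a i n3 + a i n4)}"
  have inj: "inj_on (a i) {1..}" using assms(2) by (rule strict_mono_on_imp_inj_on)
  have "inj_on (\<lambda>(n1, n2, n3, n4). (n1, n2, n3)) ?E"
  proof (rule inj_onI)
    fix x y assume xy: "x \<in> ?E" "y \<in> ?E" "(\<lambda>(n1, n2, n3, n4). (n1, n2, n3)) x = (\<lambda>(n1, n2, n3, n4). (n1, n2, n3)) y"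
    obtain n1 n2 n3 n4 n4' where eq: "x = (n1, n2, n3, n4)" "y = (n1, n2, n3, n4')"
      using xy(3) by (cases x, cases y) auto
    have "a i n1 + a i n2 = a i n3 + a i n4" "a i n1 + a i n2 = a i n3 + a i n4'"
      using xy(1,2) assms(1) by (auto simp: eq)
    then have "a i n4 = a i n4'" by simp
    then have "n4 = n4'" using inj_onD[OF inj] xy(1,2) by (auto simp: eq)
    then show "x = y" by (simp add: eq)
  qed
  moreover have "(\<lambda>(n1, n2, n3, n4). (n1, n2, n3)) ` ?E \<subseteq> {1..N} \<times> {1..N} \<times> {1..N}" by auto
  ultimately have "card ?E \<le> card ({1..N} \<times> {1..N} \<times> {1..N})" by (rule card_inj_on_le) auto
  then show ?thesis by (simp add: joint_energy_def card_cartesian_product power3_eq_cube)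
qed

text \<open>\<open>D\<close> collects the coordinates in which the ratio term is chosen. The empty
  \<open>D\<close> gives exactly the subtracted main term, so the excess runs over nonempty
  sets.\<close>

lemma overlap_prod_diff_eq:
  fixes s :: real and \<rho> :: "'d::finite \<Rightarrow> real"
  shows "(\<Prod>i\<in>UNIV. 4 * s\<^sup>2 + 2 * s * \<rho> i) - (4 * s\<^sup>2) ^ CARD('d)
    = (\<Sum>D\<in>UNIV - {{}}. (2 * s) ^ (2 * CARD('d) - card D) * (\<Prod>i\<in>D. \<rho> i))"
proof -
  have "(\<Prod>i\<in>(UNIV :: 'd set). 4 * s\<^sup>2 + 2 * s * \<rho> i)
      = (\<Sum>D\<in>Pow UNIV. (\<Prod>i\<in>D. 2 * s * \<rho> i) * (\<Prod>i\<in>UNIV - D. 4 * s\<^sup>2))"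
    by (subst prod_add[symmetric]) (simp_all add: add.commute)
  also have "\<dots> = (\<Sum>D\<in>UNIV. (2 * s) ^ (2 * CARD('d) - card D) * (\<Prod>i\<in>D. \<rho> i))"
  proof (rule sum.cong)
    fix D :: "'d set"
    have "card D \<le> CARD('d)" by (rule card_mono) auto
    have "(\<Prod>i\<in>D. 2 * s * \<rho> i) * (\<Prod>i\<in>UNIV - D. 4 * s\<^sup>2)
       = (2 * s) ^ card D * ((2 * s)\<^sup>2) ^ (CARD('d) - card D) * (\<Prod>i\<in>D. \<rho> i)"
      by (simp add: prod.distrib card_Diff_subset power_mult_distrib)
    also have "(2 * s) ^ card D * ((2 * s)\<^sup>2) ^ (CARD('d) - card D) = (2 * s) ^ (card D + 2 * (CARD('d) - card D))"
      by (simp only: power_add power_mult)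
    also have "card D + 2 * (CARD('d) - card D) = 2 * CARD('d) - card D" using \<open>card D \<le> CARD('d)\<close> by simp
    finally show "(\<Prod>i\<in>D. 2 * s * \<rho> i) * (\<Prod>i\<in>UNIV - D. 4 * s\<^sup>2)
       = (2 * s) ^ (2 * CARD('d) - card D) * (\<Prod>i\<in>D. \<rho> i)" .
  qed simp
  also have "\<dots> = (2 * s) ^ (2 * CARD('d)) + (\<Sum>D\<in>UNIV - {{}}. (2 * s) ^ (2 * CARD('d) - card D) * (\<Prod>i\<in>D. \<rho> i))"
    by (subst sum.remove[of _ "{}"]) auto
  also have "(2 * s) ^ (2 * CARD('d)) = (4 * s\<^sup>2) ^ CARD('d)"
    by (simp only: power_mult) (simp add: power_mult_distrib)
  finally show ?thesis by simp
qed

text \<open>One \<open>\<epsilon>\<close> comes from the GCD sum and the other from the energy. The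
  cut-off term \<open>N^2\<close> also fits, since \<open>card D' \<le> d\<close> makes the exponent
  at least 2.\<close>

lemma gcd_sum_index_pairs_le:
  fixes a :: "'d::finite \<Rightarrow> nat \<Rightarrow> nat"
  assumes mono: "\<And>i. strict_mono_on {1..} (a i)" and "\<epsilon> > 0" and ne: "D' \<noteq> {}"
    and energy: "real (card D') > real CARD('d) / 2 \<Longrightarrow>
      (\<lambda>N. real (joint_energy a D' N)) \<in> O(\<lambda>N. real N powr (2 + \<epsilon>))"
  shows "\<exists>C>0. \<forall>\<^sub>F N in sequentially.
    (\<Sum>p\<in>index_pairs N. \<Sum>q\<in>index_pairs N. \<Prod>i\<in>D'. gcd_ratio (a i (fst p) - a i (snd p)) (a i (fst q) - a i (snd q)))
      \<le> C * real N powr (4 + 2 * \<epsilon> - 2 * real (card D') / real CARD('d))"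
proof -
  define d j where "d = real CARD('d)" and "j = real (card D')"
  have "d > 0" by (simp add: d_def)
  have "j \<le> d" unfolding d_def j_def by (intro of_nat_mono card_mono) auto
  have E: "\<exists>C>0. \<forall>\<^sub>F N in sequentially. real (joint_energy a D' N) \<le> C * real N powr (4 + \<epsilon> - 2 * j / d)"
  proof (cases "j > d / 2")
    case True
    then obtain C where C: "C > 0" "\<forall>\<^sub>F N in sequentially. norm (real (joint_energy a D' N)) \<le> C * norm (real N powr (2 + \<epsilon>))"
      using landau_o.bigE[OF energy] unfolding d_def j_def by blast
    have "\<forall>\<^sub>F N in sequentially. real (joint_energy a D' N) \<le> C * real N powr (4 + \<epsilon> - 2 * j / d)"
      using C(2) eventually_ge_at_top[of 1]
    proof eventually_elim
      case (elim N)
      have "2 + \<epsilon> \<le> 4 + \<epsilon> - 2 * j / d" using \<open>j \<le> d\<close> \<open>d > 0\<close> by (simp add: field_simps)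
      then have "real N powr (2 + \<epsilon>) \<le> real N powr (4 + \<epsilon> - 2 * j / d)" using elim by (intro powr_mono) auto
      then have "C * real N powr (2 + \<epsilon>) \<le> C * real N powr (4 + \<epsilon> - 2 * j / d)" using C(1) by (intro mult_left_mono) auto
      then show ?case using elim by simp
    qed
    then show ?thesis using C(1) by blast
  next
    case False
    have "\<forall>\<^sub>F N in sequentially. real (joint_energy a D' N) \<le> 1 * real N powr (4 + \<epsilon> - 2 * j / d)"
      using eventually_ge_at_top[of 1]
    proof eventually_elim
      case (elim N)
      obtain i where "i \<in> D'" using ne by blast
      have "real (joint_energy a D' N) \<le> real (N ^ 3)"
        using joint_energy_le_cube[OF \<open>i \<in> D'\<close> mono] by (intro of_nat_mono)
      also have "\<dots> = real N powr 3" using elim by (simp add: powr_numeral)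
      also have "\<dots> \<le> real N powr (4 + \<epsilon> - 2 * j / d)"
      proof (rule powr_mono)
        have "2 * j / d \<le> 1" using False \<open>d > 0\<close> by (simp add: field_simps)
        then show "3 \<le> 4 + \<epsilon> - 2 * j / d" using \<open>\<epsilon> > 0\<close> by linarith
      qed (use elim in auto)
      finally show ?case by simp
    qed
    then show ?thesis by (intro exI[of _ 1]) simp
  qed
  then obtain C1 where C1: "C1 > 0"
    "\<forall>\<^sub>F N in sequentially. real (joint_energy a D' N) \<le> C1 * real N powr (4 + \<epsilon> - 2 * j / d)" by blast
  obtain C2 where C2: "C2 > 0"
    "\<And>N P (c :: nat \<times> nat \<Rightarrow> 'd \<Rightarrow> nat). \<lbrakk>N \<ge> 1; finite P; card P \<le> N\<^sup>2; \<And>p i. p \<in> P \<Longrightarrow> i \<in> D' \<Longrightarrow> c p i > 0\<rbrakk> \<Longrightarrow>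
       (\<Sum>p\<in>P. \<Sum>p'\<in>P. \<Prod>i\<in>D'. gcd_ratio (c p i) (c p' i))
         \<le> C2 * real N powr \<epsilon> * real (card {(p, p'). p \<in> P \<and> p' \<in> P \<and> (\<forall>i\<in>D'. c p i = c p' i)}) + (real N)\<^sup>2"
    using sum_prod_gcd_ratio_le[OF finite[of D'] \<open>\<epsilon> > 0\<close>] by blast
  have "\<forall>\<^sub>F N in sequentially.
    (\<Sum>p\<in>index_pairs N. \<Sum>q\<in>index_pairs N. \<Prod>i\<in>D'. gcd_ratio (a i (fst p) - a i (snd p)) (a i (fst q) - a i (snd q)))
      \<le> (C2 * C1 + 1) * real N powr (4 + 2 * \<epsilon> - 2 * j / d)"
    using C1(2) eventually_ge_at_top[of 1]
  proof eventually_elim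
    case (elim N)
    have pos: "a i (fst p) - a i (snd p) > 0" if "p \<in> index_pairs N" for p i
      using that strict_mono_onD[OF mono[of i], of "snd p" "fst p"] by (auto simp: index_pairs_def)
    have "(\<Sum>p\<in>index_pairs N. \<Sum>q\<in>index_pairs N. \<Prod>i\<in>D'. gcd_ratio (a i (fst p) - a i (snd p)) (a i (fst q) - a i (snd q)))
      \<le> C2 * real N powr \<epsilon> * real (card {(p, q). p \<in> index_pairs N \<and> q \<in> index_pairs N \<and>
        (\<forall>i\<in>D'. a i (fst p) - a i (snd p) = a i (fst q) - a i (snd q))}) + (real N)\<^sup>2"
      by (rule C2(2)[where c = "\<lambda>p i. a i (fst p) - a i (snd p)", OF elim(2) finite_index_pairs card_index_pairs_le pos])
    also have "\<dots> \<le> C2 * real N powr \<epsilon> * (C1 * real N powr (4 + \<epsilon> - 2 * j / d)) + real N powr (4 + 2 * \<epsilon> - 2 * j / d)"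
    proof (rule add_mono, rule mult_left_mono)
      show "real (card {(p, q). p \<in> index_pairs N \<and> q \<in> index_pairs N \<and>
        (\<forall>i\<in>D'. a i (fst p) - a i (snd p) = a i (fst q) - a i (snd q))}) \<le> C1 * real N powr (4 + \<epsilon> - 2 * j / d)"
        by (rule order_trans[OF of_nat_mono[OF card_equal_differences_le_joint_energy[OF mono]] elim(1)])
      have "(real N)\<^sup>2 = real N powr 2" using elim by (simp add: powr_numeral)
      also have "\<dots> \<le> real N powr (4 + 2 * \<epsilon> - 2 * j / d)"
      proof (rule powr_mono)
        have "2 * j / d \<le> 2" using \<open>j \<le> d\<close> \<open>d > 0\<close> by (simp add: field_simps)
        then show "2 \<le> 4 + 2 * \<epsilon> - 2 * j / d" using \<open>\<epsilon> > 0\<close> by linarith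
      qed (use elim in auto)
      finally show "(real N)\<^sup>2 \<le> real N powr (4 + 2 * \<epsilon> - 2 * j / d)" .
    qed (use C2(1) in auto)
    also have "\<dots> = C2 * C1 * (real N powr \<epsilon> * real N powr (4 + \<epsilon> - 2 * j / d)) + real N powr (4 + 2 * \<epsilon> - 2 * j / d)"
      by (simp add: mult_ac)
    also have "real N powr \<epsilon> * real N powr (4 + \<epsilon> - 2 * j / d) = real N powr (4 + 2 * \<epsilon> - 2 * j / d)"
      by (subst powr_add[symmetric]) (simp add: algebra_simps)
    finally show ?case by (simp add: algebra_simps)
  qed
  moreover have "C2 * C1 + 1 > 0" using C1(1) C2(1) by (simp add: add_pos_pos)
  ultimately show ?thesis unfolding d_def j_def by blast
qed

lemma min_gap_vector_ae:
  fixes a :: "'d::finite \<Rightarrow> nat \<Rightarrow> nat"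
  assumes d2: "CARD('d) \<ge> 2" and "\<delta> > 0" and mono: "\<And>i. strict_mono_on {1..} (a i)"
    and energy: "\<And>D' \<eta>. real (card D') > real CARD('d) / 2 \<Longrightarrow> \<eta> > 0 \<Longrightarrow>
      (\<lambda>N. real (joint_energy a D' N)) \<in> O(\<lambda>N. real N powr (2 + \<eta>))"
  shows "AE \<alpha> \<in> cbox 0 1 in (lebesgue :: (real ^ 'd) measure).
          \<forall>\<^sub>F N in sequentially.
            min_gap (\<lambda>n. frac_vec (\<chi> i. real (a i n) * \<alpha> $ i)) N
              \<le> real N powr \<delta> / real N powr (2 / real CARD('d))"
proof -
  define d where "d = CARD('d)"
  have d: "d \<ge> 2" "real d > 0" using d2 by (auto simp: d_def)
  \<comment> \<open>The cap \<open>1 / d\<close> makes \<open>\<tau>\<close> negative, so that the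
    distances tend to 0. With \<open>\<tau> \<ge> - 1\<close> also
    \<open>2 * 2 powr \<tau> \<ge> 1\<close>, which absorbs the shift from \<open>2^k\<close> to
    \<open>2^(k+1)\<close> in \<open>s\<close>.\<close>
  define \<delta>' where "\<delta>' = min \<delta> (1 / real d)"
  define \<tau> where "\<tau> = \<delta>' - 2 / real d"
  \<comment> \<open>The loss \<open>2 * \<epsilon> = \<delta>' / 2\<close> is compared with the gain
    \<open>\<delta>' * card D\<close> hidden in \<open>\<tau> * card D\<close>; as
    \<open>card D \<ge> 1\<close>, a saving of \<open>\<delta>' / 2\<close> remains for every
    nonempty \<open>D\<close>.\<close>
  define \<epsilon> where "\<epsilon> = \<delta>' / 4"
  have \<delta>': "\<delta>' > 0" "\<delta>' \<le> \<delta>" "\<delta>' \<le> 1 / real d" using \<open>\<delta> > 0\<close> d by (auto simp: \<delta>'_def)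
  have "2 / real d \<le> 1" "1 / real d < 2 / real d" using d by (simp_all add: divide_strict_right_mono)
  then have \<tau>: "\<tau> < 0" "\<tau> \<ge> - 1" using \<delta>' unfolding \<tau>_def by linarith+
  have "\<epsilon> > 0" using \<delta>' by (simp add: \<epsilon>_def)
  define c where "c p i = a i (fst p) - a i (snd p)" for p :: "nat \<times> nat" and i
  define P where "P k = index_pairs (2 ^ k)" for k
  \<comment> \<open>The exponent is \<open>k + 1\<close> because \<open>\<tau> < 0\<close>: then
    \<open>s k \<le> N powr \<tau>\<close> for every \<open>N < 2^(k+1)\<close>.\<close>
  define s where "s k = (2 ^ (k + 1)) powr \<tau>" for k :: nat
  have pos: "c p i > 0" if "p \<in> P k" for p k i
    using that strict_mono_onD[OF mono[of i], of "snd p" "fst p"] by (auto simp: index_pairs_def c_def P_def)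
  have spos: "s k > 0" for k by (simp add: s_def)
  have "s \<longlonglongrightarrow> 0" unfolding s_def using \<tau>(1) by real_asymp
  then have "\<forall>\<^sub>F k in sequentially. s k < 1 / 2" by (rule order_tendstoD) simp
  then have ev_s: "\<forall>\<^sub>F k in sequentially. 0 < s k \<and> s k < 1 / 2 \<and> P k \<noteq> {}"
    using eventually_gt_at_top[of 0]
  proof eventually_elim
    case (elim k)
    have "(2, 1) \<in> P k" using elim(2) self_le_power[of "2 :: nat" k] by (simp add: P_def index_pairs_def)
    then show ?case using elim spos by auto
  qed
  define T where "T k D = (\<Sum>p\<in>P k. \<Sum>q\<in>P k. \<Prod>i\<in>D. gcd_ratio (c p i) (c q i))" for k and D :: "'d set"
  have pow2: "filterlim (\<lambda>k :: nat. (2 :: nat) ^ k) sequentially sequentially"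
    by (rule filterlim_subseq) (auto simp: strict_mono_def)
  have "\<exists>C>0. \<forall>\<^sub>F k in sequentially. T k D \<le> C * real (2 ^ k) powr (4 + 2 * \<epsilon> - 2 * real (card D) / real d)"
    if D_ne: "D \<noteq> {}" for D :: "'d set"
  proof -
    obtain C where C: "C > 0" "\<forall>\<^sub>F N in sequentially.
      (\<Sum>p\<in>index_pairs N. \<Sum>q\<in>index_pairs N. \<Prod>i\<in>D. gcd_ratio (a i (fst p) - a i (snd p)) (a i (fst q) - a i (snd q)))
      \<le> C * real N powr (4 + 2 * \<epsilon> - 2 * real (card D) / real CARD('d))"
      using gcd_sum_index_pairs_le[OF mono \<open>\<epsilon> > 0\<close> D_ne energy] \<open>\<epsilon> > 0\<close> by blast
    show ?thesis
      using eventually_compose_filterlim[OF C(2) pow2] C(1) unfolding T_def P_def c_def d_def by blast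
  qed
  then obtain C where C: "\<And>D. D \<noteq> {} \<Longrightarrow> C D > 0" "\<And>D. D \<noteq> {} \<Longrightarrow> \<forall>\<^sub>F k in sequentially.
      T k D \<le> C D * real (2 ^ k) powr (4 + 2 * \<epsilon> - 2 * real (card D) / real d)" by metis
  have evT: "\<forall>\<^sub>F k in sequentially. \<forall>D\<in>UNIV - {{}}. T k D \<le> C D * real (2 ^ k) powr (4 + 2 * \<epsilon> - 2 * real (card D) / real d)"
    using C(2) by (intro eventually_ball_finite) auto
  \<comment> \<open>The factor 16 stems from \<open>card (P k) \<ge> (2^k)^2 / 4\<close>, squared.
    The saving \<open>N powr (- \<delta>' / 2)\<close> at \<open>N = 2^k\<close> makes the series
    geometric.\<close>
  define b where "b k = 16 * (\<Sum>D\<in>UNIV - {{}}. C D) * (2 powr (- \<delta>' / 2)) ^ k" for k :: nat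
  have "2 powr (- \<delta>' / 2) < (1 :: real)" using \<delta>' by (intro powr_less_one) auto
  then have b: "summable b" unfolding b_def by (intro summable_mult summable_geometric) simp
  have bound: "\<forall>\<^sub>F k in sequentially.
      (\<Sum>p\<in>P k. \<Sum>q\<in>P k. (\<Prod>i\<in>UNIV. 4 * (s k)\<^sup>2 + 2 * s k * gcd_ratio (c p i) (c q i)) - (4 * (s k)\<^sup>2) ^ CARD('d))
        \<le> b k * (real (card (P k)) * (2 * s k) ^ CARD('d))\<^sup>2"
    using evT eventually_gt_at_top[of 0]
  proof eventually_elim
    case (elim k)
    define N where "N = (2 :: real) ^ k"
    have "N > 0" "N \<ge> 1" by (auto simp: N_def)
    define S where "S = 2 * s k"
    have "S > 0" using spos by (simp add: S_def)
    have S_ge: "N powr \<tau> \<le> S"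
    proof -
      have "s k = 2 powr \<tau> * N powr \<tau>" by (simp add: s_def N_def powr_mult)
      moreover have "2 * 2 powr \<tau> \<ge> (2 :: real) * 2 powr (- 1)" using \<tau> by (intro mult_left_mono powr_mono) auto
      then have "2 * 2 powr \<tau> \<ge> (1 :: real)" by (simp add: powr_minus)
      then have "2 * 2 powr \<tau> * N powr \<tau> \<ge> 1 * N powr \<tau>" by (intro mult_right_mono) auto
      ultimately show ?thesis by (simp add: S_def)
    qed
    have cardP: "N ^ 4 \<le> 16 * (real (card (P k)))\<^sup>2"
    proof -
      obtain l where l: "k = Suc l" using elim(2) by (cases k) auto
      have "real ((2 ^ l)\<^sup>2) \<le> real (card (P k))" using card_index_pairs_ge[of "2 ^ l"] unfolding P_def l by (intro of_nat_mono) simp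
      then have "N\<^sup>2 \<le> 4 * real (card (P k))" by (simp add: N_def l power_mult_distrib)
      then have "(N\<^sup>2)\<^sup>2 \<le> (4 * real (card (P k)))\<^sup>2" by (intro power_mono) auto
      then show ?thesis by (simp add: power_mult_distrib)
    qed
    have contrib: "S ^ (2 * d - card D) * T k D \<le> C D * N powr (- \<delta>' / 2) * (N ^ 4 * S ^ (2 * d))" if "D \<noteq> {}" for D
    proof -
      have cD: "card D \<ge> 1" "card D \<le> d" using that
        by (auto simp: Suc_le_eq card_gt_0_iff d_def intro: card_mono)
      have "T k D \<le> C D * N powr (4 + 2 * \<epsilon> - 2 * real (card D) / real d)" using elim(1) that by (auto simp: N_def)
      also have "\<dots> \<le> C D * N powr (4 - \<delta>' / 2 + \<tau> * real (card D))"
      proof (intro mult_left_mono powr_mono)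
        have "\<delta>' * 1 \<le> \<delta>' * real (card D)" using \<delta>'(1) cD by (intro mult_left_mono) auto
        then show "4 + 2 * \<epsilon> - 2 * real (card D) / real d \<le> 4 - \<delta>' / 2 + \<tau> * real (card D)"
          unfolding \<tau>_def \<epsilon>_def by (simp add: algebra_simps)
      qed (use C(1)[OF that] \<open>N \<ge> 1\<close> in auto)
      also have "\<dots> = C D * N powr (- \<delta>' / 2) * (N ^ 4 * (N powr \<tau>) ^ card D)"
      proof -
        have "N powr (4 - \<delta>' / 2 + \<tau> * real (card D)) = N powr 4 * N powr (- \<delta>' / 2) * N powr (\<tau> * real (card D))"
          by (simp only: powr_add[symmetric]) (simp add: algebra_simps)
        then show ?thesis using \<open>N > 0\<close> by (simp add: powr_power mult_ac)
      qed
      also have "\<dots> \<le> C D * N powr (- \<delta>' / 2) * (N ^ 4 * S ^ card D)"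
        using C(1)[OF that] \<open>N > 0\<close> S_ge by (intro mult_left_mono power_mono) auto
      finally have "S ^ (2 * d - card D) * T k D \<le> S ^ (2 * d - card D) * (C D * N powr (- \<delta>' / 2) * (N ^ 4 * S ^ card D))"
        using \<open>S > 0\<close> by (intro mult_left_mono) auto
      also have "\<dots> = C D * N powr (- \<delta>' / 2) * (N ^ 4 * (S ^ (2 * d - card D) * S ^ card D))" by (simp add: mult_ac)
      also have "S ^ (2 * d - card D) * S ^ card D = S ^ (2 * d)" using cD by (simp flip: power_add)
      finally show ?thesis .
    qed
    have "(\<Sum>p\<in>P k. \<Sum>q\<in>P k. (\<Prod>i\<in>UNIV. 4 * (s k)\<^sup>2 + 2 * s k * gcd_ratio (c p i) (c q i)) - (4 * (s k)\<^sup>2) ^ CARD('d))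
       = (\<Sum>p\<in>P k. \<Sum>q\<in>P k. \<Sum>D\<in>UNIV - {{}}. S ^ (2 * d - card D) * (\<Prod>i\<in>D. gcd_ratio (c p i) (c q i)))"
      by (simp only: overlap_prod_diff_eq S_def d_def)
    also have "\<dots> = (\<Sum>p\<in>P k. \<Sum>D\<in>UNIV - {{}}. \<Sum>q\<in>P k. S ^ (2 * d - card D) * (\<Prod>i\<in>D. gcd_ratio (c p i) (c q i)))"
      by (intro sum.cong refl sum.swap)
    also have "\<dots> = (\<Sum>D\<in>UNIV - {{}}. \<Sum>p\<in>P k. \<Sum>q\<in>P k. S ^ (2 * d - card D) * (\<Prod>i\<in>D. gcd_ratio (c p i) (c q i)))"
      by (rule sum.swap)
    also have "\<dots> = (\<Sum>D\<in>UNIV - {{}}. S ^ (2 * d - card D) * T k D)"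
      unfolding T_def by (simp only: sum_distrib_left)
    also have "\<dots> \<le> (\<Sum>D\<in>UNIV - {{}}. C D * N powr (- \<delta>' / 2) * (N ^ 4 * S ^ (2 * d)))"
      by (intro sum_mono contrib) auto
    also have "\<dots> = (\<Sum>D\<in>UNIV - {{}}. C D) * N powr (- \<delta>' / 2) * S ^ (2 * d) * N ^ 4"
      unfolding sum_distrib_right by (simp only: mult_ac)
    also have "\<dots> \<le> (\<Sum>D\<in>UNIV - {{}}. C D) * N powr (- \<delta>' / 2) * S ^ (2 * d) * (16 * (real (card (P k)))\<^sup>2)"
      using C(1) \<open>S > 0\<close> by (intro mult_left_mono cardP mult_nonneg_nonneg sum_nonneg) (auto intro: less_imp_le)
    also have "\<dots> = 16 * (\<Sum>D\<in>UNIV - {{}}. C D) * N powr (- \<delta>' / 2) * (real (card (P k)) * S ^ d)\<^sup>2"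
      unfolding power_mult_distrib power_even_eq by (simp only: mult_ac)
    also have "N powr (- \<delta>' / 2) = (2 powr (- \<delta>' / 2)) ^ k"
      by (simp add: N_def powr_power powr_powr mult.commute flip: powr_realpow)
    finally show ?case by (simp add: b_def S_def d_def)
  qed
  have "AE \<alpha> \<in> cbox 0 1 in lebesgue. \<forall>\<^sub>F k in sequentially. \<exists>p\<in>P k. \<alpha> \<in> near_set (s k) (c p)"
    using pos ev_s b bound by (intro AE_eventually_in_near_set) (auto simp: P_def finite_index_pairs)
  then show ?thesis
  proof eventually_elim
    case (elim \<alpha>)
    show ?case
    proof
      assume "\<alpha> \<in> cbox 0 1"
      then obtain k0 where k0: "\<And>k. k \<ge> k0 \<Longrightarrow> \<exists>p\<in>P k. \<alpha> \<in> near_set (s k) (c p)"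
        using elim by (auto simp: eventually_sequentially)
      show "\<forall>\<^sub>F N in sequentially. min_gap (\<lambda>n. frac_vec (\<chi> i. real (a i n) * \<alpha> $ i)) N
              \<le> real N powr \<delta> / real N powr (2 / real CARD('d))"
        using eventually_ge_at_top[of "2 ^ k0"]
      proof eventually_elim
        case (elim N)
        then have "1 \<le> N" using order_trans[OF one_le_power[of "2 :: nat" k0]] by simp
        then obtain k where k: "2 ^ k \<le> N" "N < 2 ^ (k + 1)"
          using ex_power_ivl1[of 2 N] by auto
        have "(2 :: nat) ^ k0 < 2 ^ (k + 1)" using elim k by linarith
        then have "k0 < k + 1" by (rule power_less_imp_less_exp[rotated]) simp
        then obtain p where p: "p \<in> P k" "\<alpha> \<in> near_set (s k) (c p)" using k0[of k] by auto
        define n m where "n = fst p" and "m = snd p"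
        have nm: "n \<in> {1..N}" "m \<in> {1..N}" "m < n"
          using p(1) k(1) by (auto simp: P_def index_pairs_def n_def m_def)
        have "near_int (s k) ((\<chi> i. real (a i n) * \<alpha> $ i) $ i - (\<chi> i. real (a i m) * \<alpha> $ i) $ i)" for i
        proof -
          have "a i m \<le> a i n" using strict_mono_onD[OF mono[of i], of m n] nm by auto
          then have "real (c p i) * \<alpha> $ i = real (a i n) * \<alpha> $ i - real (a i m) * \<alpha> $ i"
            by (simp add: c_def n_def m_def of_nat_diff left_diff_distrib)
          then show ?thesis using p(2) by (auto simp: near_set_def dest: spec[of _ i])
        qed
        then have "nid_infnorm (frac_vec (\<chi> i. real (a i n) * \<alpha> $ i) - frac_vec (\<chi> i. real (a i m) * \<alpha> $ i)) \<le> s k"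
          by (rule nid_infnorm_frac_vec_diff_le)
        moreover have "n \<noteq> m" using nm(3) by auto
        ultimately have "min_gap (\<lambda>n. frac_vec (\<chi> i. real (a i n) * \<alpha> $ i)) N \<le> s k"
          using min_gap_le[OF nm(1,2), of "\<lambda>n. frac_vec (\<chi> i. real (a i n) * \<alpha> $ i)"] by linarith
        also have "s k \<le> real N powr \<tau>"
          unfolding s_def
        proof (rule powr_mono2')
          show "real N \<le> 2 ^ (k + 1)" using k(2) by (metis less_imp_le of_nat_le_iff of_nat_numeral of_nat_power)
        qed (use \<tau> \<open>1 \<le> N\<close> in auto)
        also have "\<dots> \<le> real N powr (\<delta> - 2 / real d)"
          using \<delta>' \<open>1 \<le> N\<close> by (intro powr_mono) (auto simp: \<tau>_def)
        finally show ?case using \<open>1 \<le> N\<close> by (simp add: powr_diff d_def)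
      qed
    qed
  qed
qed

theorem theorem1p2:
  fixes \<delta> :: real
  assumes "CARD('d::finite) \<ge> 2" and "\<delta> > 0"
  shows
    "(\<forall>a :: nat \<Rightarrow> int. inj_on a {1..} \<longrightarrow>
       (AE \<alpha> \<in> cbox 0 1 in (lebesgue :: (real ^ 'd) measure).
          \<forall>\<^sub>F N in sequentially.
            min_gap (\<lambda>n. frac_vec (real_of_int (a n) *\<^sub>R \<alpha>)) N
              \<le> ln (real N) powr (1 + 1 / real CARD('d) + \<delta>)
                  / real (num_pos_diffs a N) powr (1 / real CARD('d))))
     \<and>
     (\<forall>a :: 'd \<Rightarrow> nat \<Rightarrow> nat.
       (\<forall>i. strict_mono_on {1..} (a i)) \<longrightarrow>
       (\<forall>D' :: 'd set. real (card D') > real CARD('d) / 2 \<longrightarrow>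
          (\<forall>\<eta>>0. (\<lambda>N. real (joint_energy a D' N)) \<in> O(\<lambda>N. real N powr (2 + \<eta>)))) \<longrightarrow>
       (AE \<alpha> \<in> cbox 0 1 in (lebesgue :: (real ^ 'd) measure).
          \<forall>\<^sub>F N in sequentially.
            min_gap (\<lambda>n. frac_vec (\<chi> i. real (a i n) * \<alpha> $ i)) N
              \<le> real N powr \<delta> / real N powr (2 / real CARD('d))))"
proof (intro conjI allI impI)
  fix a :: "nat \<Rightarrow> int"
  assume "inj_on a {1..}"
  with assms show "AE \<alpha> \<in> cbox 0 1 in (lebesgue :: (real ^ 'd) measure). \<forall>\<^sub>F N in sequentially.
      min_gap (\<lambda>n. frac_vec (real_of_int (a n) *\<^sub>R \<alpha>)) N
        \<le> ln (real N) powr (1 + 1 / real CARD('d) + \<delta>) / real (num_pos_diffs a N) powr (1 / real CARD('d))"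
    by (rule min_gap_scalar_ae)
next
  fix a :: "'d \<Rightarrow> nat \<Rightarrow> nat"
  assume "\<forall>i. strict_mono_on {1..} (a i)"
    and "\<forall>D' :: 'd set. real (card D') > real CARD('d) / 2 \<longrightarrow>
          (\<forall>\<eta>>0. (\<lambda>N. real (joint_energy a D' N)) \<in> O(\<lambda>N. real N powr (2 + \<eta>)))"
  with assms show "AE \<alpha> \<in> cbox 0 1 in (lebesgue :: (real ^ 'd) measure). \<forall>\<^sub>F N in sequentially.
      min_gap (\<lambda>n. frac_vec (\<chi> i. real (a i n) * \<alpha> $ i)) N \<le> real N powr \<delta> / real N powr (2 / real CARD('d))"
    by (intro min_gap_vector_ae) blast+
qed

end
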